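(* For $a,c\in\mathbb{Z}_{\ge 0}$, $\zeta^{\sqcup\!\sqcup}(\{1\}^a,2,\{1\}^c),\ \zeta^{\ast}(\{1\}^a,2,\{1\}^c)\in\mathbb{Q}[\pi^2,\zeta(3),\zeta(5),\zeta(7),\ldots]$. More explicitly, \begin{align*} \zeta^{\sqcup\!\sqcup}(\{1\}^a,2,\{1\}^c) &=(-1)^c\binom{a+c+1}{c}\zeta(a+c+2),\\ \zeta^{\ast}(\{1\}^a,2,\{1\}^c) &=(-1)^c\sum^{c}_{s=0}\binom{a+c-s+1}{c-s} \zeta(a+c-s+2)C_s. \end{align*}
   Context: Let $\mathfrak{H}=\mathbb{Q}\langle e_0,e_1\rangle$ be the Hoffman algebra, $\mathfrak{H}^1=\mathbb{Q}+e_1\mathfrak{H}$, $\mathfrak{H}^0=\mathbb{Q}+e_1\mathfrak{H}e_0$, $z_k:=e_1e_0^{k-1}$, and $Z:\mathfrak{H}^0\to\mathbb{R}$ the evaluation map $Z(z_{k_1}\cdots z_{k_d})=\zeta(k_1,\ldots,k_d)$ (multiple zeta values $\zeta(k_1,\ldots,k_d)=\sum_{1\le m_1<\cdots<m_d}m_1^{-k_1}\cdots m_d^{-k_d}$). Let $\ast$ (stuffle/harmonic product) and $\sqcup\!\sqcup$ (shuffle product) make $\mathfrak{H}^1$ commutative algebras, and let $Z^{\ast}$, $Z^{\sqcup\!\sqcup}:\mathfrak{H}^1\to\mathbb{R}[T]$ be the unique $\mathbb{Q}$-algebra homomorphisms (for $\ast$, resp. $\sqcup\!\sqcup$) extending $Z$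 on $\mathfrak{H}^0$ with $Z^{\ast}(z_1)=Z^{\sqcup\!\sqcup}(z_1)=T$. For an index $\boldsymbol k=(k_1,\ldots,k_d)$ put $Z^{\ast}(\boldsymbol k;T)=Z^{\ast}(z_{k_1}\cdots z_{k_d})$, $Z^{\sqcup\!\sqcup}(\boldsymbol k;T)=Z^{\sqcup\!\sqcup}(z_{k_1}\cdots z_{k_d})$, and $\zeta^{\ast}(\boldsymbol k)=Z^{\ast}(\boldsymbol k;0)$, $\zeta^{\sqcup\!\sqcup}(\boldsymbol k)=Z^{\sqcup\!\sqcup}(\boldsymbol k;0)$ (stuffle and shuffle regularized multiple zeta values). $\{\alpha\}^m$ denotes $\alpha$ repeated $m$ times. The sequence $\{C_s\}_{s\ge0}$ is defined by $C_0=1$, $C_1=0$, and for $s\ge2$ $$C_s=\sum_{\substack{k_2,\ldots,k_s\ge0\\2k_2+3k_3+\cdots+sk_s=s}}\frac{(-1)^{k_2+\cdots+k_s}}{k_2!\cdots k_s!}\left(\frac{\zeta(2)}{2}\right)^{k_2}\cdots\left(\frac{\zeta(s)}{s}\right)^{k_s}.$$ *)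

theory Defs
  imports
    "HOL-Analysis.Analysis"
    "HOL-Library.Poly_Mapping"
    "HOL-Computational_Algebra.Polynomial"
begin

section \<open>The Hoffman algebra\<close>

datatype letter = E0 | E1

text \<open>Words form the free monoid on the two letters, written additively: this way the convolution
  product of finitely supported functions on words is the concatenation product of the
  noncommutative polynomial ring.\<close>

datatype hword = Word (letters: "letter list")

instantiation hword :: monoid_add
begin

definition zero_hword :: hword where
  "0 = Word []"

definition plus_hword :: "hword \<Rightarrow> hword \<Rightarrow> hword" where
  "u + v = Word (letters u @ letters v)"

instance
  by standard (auto simp: zero_hword_def plus_hword_def)

end

type_synonym hoffman = "hword \<Rightarrow>\<^sub>0 rat"

definition scal :: "rat \<Rightarrow> hoffman" where
  "scal q = Poly_Mapping.single 0 q"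

definition lett :: "letter \<Rightarrow> hoffman" where
  "lett a = Poly_Mapping.single (Word [a]) 1"

abbreviation e0 :: hoffman where "e0 \<equiv> lett E0"
abbreviation e1 :: hoffman where "e1 \<equiv> lett E1"

definition H1 :: "hoffman set" where
  "H1 = {scal q + e1 * x | q x. True}"

definition H0 :: "hoffman set" where
  "H0 = {scal q + e1 * x * e0 | q x. True}"

definition zgen :: "nat \<Rightarrow> hoffman" where
  "zgen k = e1 * e0 ^ (k - 1)"

definition zmon :: "nat list \<Rightarrow> hoffman" where
  "zmon ks = prod_list (map zgen ks)"

text \<open>The index of a word: a word in the span of the \<open>zgen\<close>-monomials, i.e. one that is empty or
  starts with \<open>e1\<close>, is cut into blocks, a letter \<open>e1\<close> followed by \<open>k - 1\<close> letters \<open>e0\<close> giving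
  the entry \<open>k\<close>. The value on words starting with \<open>e0\<close> is irrelevant.\<close>

function index_of :: "letter list \<Rightarrow> nat list" where
  "index_of [] = []"
| "index_of (E0 # w) = []"
| "index_of (E1 # w) =
     Suc (length (takeWhile (\<lambda>a. a = E0) w)) # index_of (dropWhile (\<lambda>a. a = E0) w)"
  by pat_completeness auto
termination
  by (relation "Wellfounded.measure length") (auto simp: length_dropWhile_le less_Suc_eq_le)

section \<open>Shuffle and stuffle products\<close>

definition bilinear_ext :: "(hword \<Rightarrow> hword \<Rightarrow> hoffman) \<Rightarrow> hoffman \<Rightarrow> hoffman \<Rightarrow> hoffman" where
  "bilinear_ext f x y =
     (\<Sum>u\<in>Poly_Mapping.keys x. \<Sum>v\<in>Poly_Mapping.keys y.
        scal (Poly_Mapping.lookup x u * Poly_Mapping.lookup y v) * f u v)"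

fun shuffle_words :: "letter list \<Rightarrow> letter list \<Rightarrow> hoffman" where
  "shuffle_words [] v = Poly_Mapping.single (Word v) 1"
| "shuffle_words u [] = Poly_Mapping.single (Word u) 1"
| "shuffle_words (a # u) (b # v) =
     lett a * shuffle_words u (b # v) + lett b * shuffle_words (a # u) v"

definition shuffle_prod :: "hoffman \<Rightarrow> hoffman \<Rightarrow> hoffman" where
  "shuffle_prod = bilinear_ext (\<lambda>u v. shuffle_words (letters u) (letters v))"

fun stuffle_indices :: "nat list \<Rightarrow> nat list \<Rightarrow> hoffman" where
  "stuffle_indices [] ls = zmon ls"
| "stuffle_indices ks [] = zmon ks"
| "stuffle_indices (k # ks) (l # ls) =
     zgen k * stuffle_indices ks (l # ls) + zgen l * stuffle_indices (k # ks) ls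
     + zgen (k + l) * stuffle_indices ks ls"

text \<open>Only meaningful on \<open>H1\<close>, where the \<open>zgen\<close>-monomials form a basis.\<close>

definition stuffle_prod :: "hoffman \<Rightarrow> hoffman \<Rightarrow> hoffman" where
  "stuffle_prod =
     bilinear_ext (\<lambda>u v. stuffle_indices (index_of (letters u)) (index_of (letters v)))"

section \<open>Multiple zeta values and their regularizations\<close>

definition mzv :: "nat list \<Rightarrow> real" where
  "mzv ks = infsum (\<lambda>ms. \<Prod>i<length ks. 1 / real (ms ! i) ^ (ks ! i))
     {ms. length ms = length ks \<and> sorted_wrt (<) ms \<and> (\<forall>m\<in>set ms. 1 \<le> m)}"

text \<open>The evaluation map, to be used on \<open>H0\<close> only.\<close>

definition Zeval :: "hoffman \<Rightarrow> real" where
  "Zeval x = (\<Sum>w\<in>Poly_Mapping.keys x.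
     of_rat (Poly_Mapping.lookup x w) * mzv (index_of (letters w)))"

definition rat_alg_hom_H1 ::
    "(hoffman \<Rightarrow> hoffman \<Rightarrow> hoffman) \<Rightarrow> (hoffman \<Rightarrow> real poly) \<Rightarrow> bool" where
  "rat_alg_hom_H1 prd F \<longleftrightarrow>
     F 1 = 1 \<and>
     (\<forall>x\<in>H1. \<forall>y\<in>H1. F (x + y) = F x + F y) \<and>
     (\<forall>q. \<forall>x\<in>H1. F (scal q * x) = smult (of_rat q) (F x)) \<and>
     (\<forall>x\<in>H1. \<forall>y\<in>H1. F (prd x y) = F x * F y)"

text \<open>These properties determine \<open>F\<close> on \<open>H1\<close>; its values elsewhere are unconstrained.\<close>

definition is_regularization ::
    "(hoffman \<Rightarrow> hoffman \<Rightarrow> hoffman) \<Rightarrow> (hoffman \<Rightarrow> real poly) \<Rightarrow> bool" where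
  "is_regularization prd F \<longleftrightarrow>
     rat_alg_hom_H1 prd F \<and> (\<forall>x\<in>H0. F x = [:Zeval x:]) \<and> F (zgen 1) = [:0, 1:]"

definition reg_value :: "(hoffman \<Rightarrow> real poly) \<Rightarrow> nat list \<Rightarrow> real" where
  "reg_value F ks = poly (F (zmon ks)) 0"

section \<open>The numbers \<open>Cseq s\<close> and the generated subalgebra\<close>

definition Cseq :: "nat \<Rightarrow> real" where
  "Cseq s = (if s = 0 then 1 else if s = 1 then 0 else
     (\<Sum>k \<in> {k \<in> {2..s} \<rightarrow>\<^sub>E (UNIV :: nat set). (\<Sum>i=2..s. i * k i) = s}.
        (- 1) ^ (\<Sum>i=2..s. k i) / (\<Prod>i=2..s. fact (k i))
          * (\<Prod>i=2..s. (mzv [i] / real i) ^ k i)))"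

text \<open>The \<open>\<rat>\<close>-subalgebra of the reals generated by a set.\<close>

inductive_set rat_subalgebra :: "real set \<Rightarrow> real set" for G where
  "of_rat q \<in> rat_subalgebra G"
| "x \<in> G \<Longrightarrow> x \<in> rat_subalgebra G"
| "x \<in> rat_subalgebra G \<Longrightarrow> y \<in> rat_subalgebra G \<Longrightarrow> x + y \<in> rat_subalgebra G"
| "x \<in> rat_subalgebra G \<Longrightarrow> y \<in> rat_subalgebra G \<Longrightarrow> x * y \<in> rat_subalgebra G"

section \<open>Consistency of the encoding\<close>

lemma e0_power: "e0 ^ n = Poly_Mapping.single (Word (replicate n E0)) 1"
  by (induction n) (simp_all add: lett_def mult_single plus_hword_def flip: zero_hword_def)

lemma zgen_eq_single: "zgen k = Poly_Mapping.single (Word (E1 # replicate (k - 1) E0)) 1"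
  by (simp add: zgen_def e0_power) (simp add: lett_def mult_single plus_hword_def)

definition index_word :: "nat list \<Rightarrow> letter list" where
  "index_word ks = concat (map (\<lambda>k. E1 # replicate (k - 1) E0) ks)"

lemma zmon_eq_single: "zmon ks = Poly_Mapping.single (Word (index_word ks)) 1"
proof (induction ks)
  case Nil
  then show ?case
    by (simp add: zmon_def index_word_def flip: zero_hword_def)
next
  case (Cons k ks)
  then show ?case
    by (simp add: zmon_def index_word_def zgen_eq_single mult_single plus_hword_def)
qed

lemma blocks_E0:
    "dropWhile (\<lambda>a. a = E0) (replicate n E0 @ index_word ks) = index_word ks"
    "takeWhile (\<lambda>a. a = E0) (replicate n E0 @ index_word ks) = replicate n E0"
  by (induction n; cases ks; simp add: index_word_def)+

lemma index_of_index_word: "\<forall>k\<in>set ks. 1 \<le> k \<Longrightarrow> index_of (index_word ks) = ks"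
proof (induction ks)
  case Nil
  then show ?case by (simp add: index_word_def)
next
  case (Cons k ks)
  have split: "index_word (k # ks) = E1 # replicate (k - 1) E0 @ index_word ks"
    by (simp add: index_word_def)
  show ?case
    using Cons
    by (simp add: split blocks_E0)
qed

lemma bilinear_ext_single:
  "bilinear_ext f (Poly_Mapping.single u 1) (Poly_Mapping.single v 1) = f u v"
  by (simp add: bilinear_ext_def scal_def)

lemma stuffle_prod_zmon:
  assumes "\<forall>k\<in>set ks. 1 \<le> k" "\<forall>l\<in>set ls. 1 \<le> l"
  shows "stuffle_prod (zmon ks) (zmon ls) = stuffle_indices ks ls"
  using assms
  by (simp add: stuffle_prod_def zmon_eq_single bilinear_ext_single index_of_index_word)

lemma shuffle_prod_words:
  "shuffle_prod (Poly_Mapping.single (Word u) 1) (Poly_Mapping.single (Word v) 1)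
     = shuffle_words u v"
  by (simp add: shuffle_prod_def bilinear_ext_single)

lemma Zeval_zmon: "\<forall>k\<in>set ks. 1 \<le> k \<Longrightarrow> Zeval (zmon ks) = mzv ks"
  by (simp add: Zeval_def zmon_eq_single index_of_index_word)

end

theory Submission
  imports Defs "HOL-Real_Asymp.Real_Asymp"
begin

text \<open>Among the sums truncated at \<open>M\<close>, the generating function of the \<open>\<zeta>\<^sub>M({1}\<^sup>c)\<close> is the product of
  \<open>1 + x/n\<close> over \<open>n < M\<close>. Dividing by it the generating function (in \<open>c\<close>) of the
  \<open>\<zeta>\<^sub>M({1}\<^sup>a, 2, {1}\<^sup>c)\<close> leaves a sum which converges as \<open>M\<close> grows. With a second variable \<open>y\<close> for \<open>a\<close>,
  and \<open>x\<close> replaced by \<open>- x\<close>, its limit is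
  \<open>\<Sum>\<^sub>m (1 + y)\<^sub>m\<^sub>-\<^sub>1 / (m (1 - x)\<^sub>m) = \<Sum>\<^sub>k 1 / ((k - x) (k - x - y))\<close>, which follows by summing
  \<open>(1 + y)\<^sub>m\<^sub>-\<^sub>1 (1 - x)\<^sub>k\<^sub>-\<^sub>1 / (1 - x)\<^sub>m\<^sub>+\<^sub>k\<close> in both orders, since both inner sums telescope. Its coefficients are
  \<open>binom(a + j + 1, j) \<zeta>(a + j + 2)\<close>.

  The division lifts to the stuffle algebra: the quotients \<open>tail_word a j\<close> are killed by the derivation
  that removes a final \<open>z\<^sub>1\<close>, so they lie in \<open>H0\<close> and their regularized values are the limits just
  computed. Newton's identities give \<open>\<zeta>\<^sup>*({1}\<^sup>s) = (-1)\<^sup>s C\<^sub>s\<close>. On the shuffle side, \<open>e\<^sub>1\<^sup>c\<close> has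
  regularized value 0 for \<open>c > 0\<close>, so the shuffle of \<open>e\<^sub>1\<^sup>a\<^sup>+\<^sup>1 e\<^sub>0\<close> with \<open>e\<^sub>1\<^sup>c\<close> yields a recursion in \<open>c\<close>, starting
  from \<open>\<zeta>({1}\<^sup>a, 2) = \<zeta>(a + 2)\<close>, the case \<open>j = 0\<close>.\<close>

section \<open>A double series\<close>

text \<open>Tonelli's theorem for iterated series: nonnegativity turns the row sums into one
  unconditional sum over all pairs. Convergence of each column is part of the conclusion because the
  applications do not know it beforehand.\<close>

lemma sums_swap_nonneg:
  fixes f :: "nat \<Rightarrow> nat \<Rightarrow> real"
  assumes nonneg: "\<And>m k. f m k \<ge> 0"
    and rows: "\<And>m. f m sums r m" and total: "r sums S"
  shows "summable (\<lambda>m. f m k)" and "(\<lambda>k. suminf (\<lambda>m. f m k)) sums S"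
proof -
  have r0: "r m \<ge> 0" for m
    by (rule sums_le[OF _ sums_zero rows[of m]]) (rule nonneg)
  have rows': "((\<lambda>k. (\<lambda>(m, k). f m k) (m, k)) has_sum r m) UNIV" for m
    using sums_nonneg_imp_has_sum[OF rows] nonneg by simp
  have total': "(r has_sum S) UNIV"
    using sums_nonneg_imp_has_sum[OF total] r0 by simp
  have "(\<lambda>(m, k). f m k) summable_on UNIV \<times> UNIV"
    by (rule summable_on_SigmaI[OF rows']) (use total' nonneg in \<open>auto simp: summable_on_def\<close>)
  then have "((\<lambda>(m, k). f m k) has_sum S) (UNIV \<times> UNIV)"
    by (intro has_sum_SigmaI[OF rows' total']) auto
  then have sw: "((\<lambda>(k, m). f m k) has_sum S) (UNIV \<times> UNIV)"
    by (subst (asm) has_sum_swap) simp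
  then have cols: "(\<lambda>m. f m k) summable_on UNIV" for k
    by (intro summable_on_SigmaD1[where f = "\<lambda>k m. f m k" and A = UNIV and B = "\<lambda>_. UNIV"]) (auto simp: summable_on_def)
  then show sm: "summable (\<lambda>m. f m k)" for k
    by (simp add: summable_on_UNIV_nonneg_real_iff nonneg)
  have "((\<lambda>m. f m k) has_sum (suminf (\<lambda>m. f m k))) UNIV" for k
    by (intro sums_nonneg_imp_has_sum summable_sums sm nonneg)
  then have "((\<lambda>k. suminf (\<lambda>m. f m k)) has_sum S) UNIV"
    by (intro has_sum_SigmaD[OF sw]) simp
  then show "(\<lambda>k. suminf (\<lambda>m. f m k)) sums S"
    by (rule has_sum_imp_sums)
qed

text \<open>Only positive arguments are available, since the interchange of sums relies on
  nonnegative terms. After division by the lowest power with different coefficients, the right-hand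
  limit at 0 would have to be both nonzero and 0.\<close>

lemma powser_unique_right:
  fixes a b :: "nat \<Rightarrow> real"
  assumes e: "0 < e"
    and eq: "\<And>y. 0 < y \<Longrightarrow> y < e \<Longrightarrow> \<exists>S. (\<lambda>n. a n * y ^ n) sums S \<and> (\<lambda>n. b n * y ^ n) sums S"
  shows "a = b"
proof (rule ccontr)
  assume "a \<noteq> b"
  define d where "d n = a n - b n" for n
  define N where "N = (LEAST n. d n \<noteq> 0)"
  obtain n where "d n \<noteq> 0"
    using \<open>a \<noteq> b\<close> by (auto simp: d_def)
  then have dN: "d N \<noteq> 0" and lt: "\<And>n. n < N \<Longrightarrow> d n = 0"
    unfolding N_def using LeastI[of "\<lambda>n. d n \<noteq> 0"] not_less_Least by auto
  have zero: "(\<lambda>n. d n * y ^ n) sums 0" if y: "0 < y" "y < e" for y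
  proof -
    obtain S where "(\<lambda>n. a n * y ^ n) sums S" "(\<lambda>n. b n * y ^ n) sums S"
      using eq[OF y] by blast
    from sums_diff[OF this] show ?thesis
      by (simp add: d_def left_diff_distrib)
  qed
  have shifted: "(\<lambda>n. d (n + N) * y ^ n) sums 0" if "0 < y" "y < e" for y
  proof -
    have "(\<lambda>n. d (n + N) * y ^ (n + N)) sums 0"
      using zero[OF that] by (subst sums_iff_shift) (simp add: lt)
    then have "(\<lambda>n. d (n + N) * y ^ (n + N) / y ^ N) sums (0 / y ^ N)"
      by (rule sums_divide)
    then show ?thesis
      using that by (simp add: power_add)
  qed
  have "summable (\<lambda>n. d (n + N) * (e / 2) ^ n)"
    using shifted[of "e / 2"] e by (auto simp: sums_iff)
  then have cont: "isCont (\<lambda>x. suminf (\<lambda>n. d (n + N) * x ^ n)) 0"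
    by (rule isCont_powser) (use e in auto)
  have "((\<lambda>x. suminf (\<lambda>n. d (n + N) * x ^ n)) \<longlongrightarrow> d N) (at_right 0)"
    using tendsto_within_subset[OF cont[unfolded isCont_def], of "{0<..}"] by simp
  moreover have "((\<lambda>x. suminf (\<lambda>n. d (n + N) * x ^ n)) \<longlongrightarrow> 0) (at_right 0)"
  proof (rule tendsto_eventually)
    show "\<forall>\<^sub>F x in at_right 0. (suminf (\<lambda>n. d (n + N) * x ^ n)) = 0"
      using e shifted by (auto simp: eventually_at_right sums_iff)
  qed
  ultimately have "d N = 0"
    using tendsto_unique trivial_limit_at_right_real by blast
  with dN show False by simp
qed

text \<open>The inner sum over \<open>k\<close> of the double series. It telescopes since
  \<open>(1 - x + m + k + 1) - (1 - x + k) = m + 1\<close> does not depend on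
  \<open>k\<close>.\<close>

lemma pochhammer_quotient_telescope:
  fixes x :: real
  assumes x: "0 \<le> x" "x < 1"
  shows "(\<lambda>k. pochhammer (1 - x) k / pochhammer (1 - x) (m + k + 2))
    sums (1 / ((real m + 1) * pochhammer (1 - x) (m + 1)))"
proof -
  define V where "V k = pochhammer (1 - x) k / pochhammer (1 - x) (m + k + 1)" for k
  have pos: "pochhammer (1 - x) k > 0" for k
    by (rule pochhammer_pos) (use x in auto)
  \<comment> \<open>Of the \<open>m + 1\<close> factors left in the denominator, all but the first
    are at least 1, which gives decay in \<open>k\<close> for every \<open>m\<close>.\<close>
  have V: "V k \<le> 1 / (1 - x + real k)" "0 \<le> V k" for k
  proof -
    have split: "pochhammer (1 - x) (m + k + 1) =
        pochhammer (1 - x) k * ((1 - x + real k) * pochhammer (1 - x + real k + 1) m)"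
      using pochhammer_product'[of "1 - x" k "Suc m"] pochhammer_rec[of "1 - x + real k" m]
      by (simp only: add_ac add_Suc_right add_Suc Suc_eq_plus1)
    have "1 \<le> pochhammer (1 - x + real k + 1) m"
      unfolding pochhammer_prod by (rule prod_ge_1) (use x in auto)
    then have "(1 - x + real k) * 1 \<le> (1 - x + real k) * pochhammer (1 - x + real k + 1) m"
      using x by (intro mult_left_mono) auto
    moreover have "V k = 1 / ((1 - x + real k) * pochhammer (1 - x + real k + 1) m)"
      using pos[of k] unfolding V_def split by (subst nonzero_divide_mult_cancel_left) auto
    ultimately show "V k \<le> 1 / (1 - x + real k)"
      using x by (auto intro!: divide_left_mono mult_pos_pos pochhammer_pos)
    show "0 \<le> V k"
      using pos by (simp add: V_def less_imp_le)
  qed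
  have "(\<lambda>k. 1 / (1 - x + real k)) \<longlonglongrightarrow> 0"
    by real_asymp
  then have "V \<longlonglongrightarrow> 0"
    using V by (intro tendsto_sandwich[OF _ _ tendsto_const[of 0], of V]) auto
  then have "(\<lambda>k. V k - V (Suc k)) sums (V 0 - 0)"
    by (rule telescope_sums')
  moreover have "V k - V (Suc k) =
      (real m + 1) * (pochhammer (1 - x) k / pochhammer (1 - x) (m + k + 2))" for k
  proof -
    have "V k = pochhammer (1 - x) k * (1 - x + real (m + k + 1)) / pochhammer (1 - x) (m + k + 2)"
      using pos[of "m + k + 1"] x by (simp add: V_def pochhammer_Suc divide_simps)
    moreover have "V (Suc k) = pochhammer (1 - x) k * (1 - x + real k) / pochhammer (1 - x) (m + k + 2)"
      by (simp add: V_def pochhammer_Suc)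
    ultimately show ?thesis
      by (simp add: diff_divide_distrib[symmetric] algebra_simps)
  qed
  ultimately have "(\<lambda>k. (real m + 1) * (pochhammer (1 - x) k / pochhammer (1 - x) (m + k + 2)))
      sums V 0"
    by simp
  from sums_divide[OF this, of "real m + 1"] show ?thesis
    by (simp add: V_def mult.commute)
qed

text \<open>The quotient behaves like \<open>m\<close> to the power \<open>x + y - 1\<close>. An
  elementary bound suffices: for \<open>x, y \<le> 1/6\<close> its square times \<open>m + 1\<close>
  is nonincreasing, hence it is \<open>O(1 / sqrt m)\<close>.\<close>

lemma pochhammer_quotient_tendsto_0:
  fixes x y :: real
  assumes "0 \<le> x" "x \<le> 1/6" "0 \<le> y" "y \<le> 1/6"
  shows "(\<lambda>m. pochhammer (1 + y) m / pochhammer (1 - x) (m + 1)) \<longlonglongrightarrow> 0"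
proof -
  define U where "U m = pochhammer (1 + y) m / pochhammer (1 - x) (m + 1)" for m
  have pos: "pochhammer (1 - x) m > 0" "pochhammer (1 + y) m > 0" for m
    by (rule pochhammer_pos; use assms in auto)+
  have U0: "U m \<ge> 0" for m
    using pos by (simp add: U_def less_imp_le)
  have step: "(U (Suc m))\<^sup>2 * (real m + 2) \<le> (U m)\<^sup>2 * (real m + 1)" for m
  proof -
    \<comment> \<open>\<open>u / v\<close> is the ratio of consecutive terms; 7/6 and 11/6 come from
      the bounds on \<open>y\<close> and \<open>x\<close>.\<close>
    define u v where "u = real m + 1 + y" and "v = real m + 2 - x"
    have uv: "0 \<le> u" "u \<le> real m + 7/6" "real m + 11/6 \<le> v" "0 < v"
      using assms by (auto simp: u_def v_def)
    have "u\<^sup>2 * (real m + 2) \<le> (real m + 7/6)\<^sup>2 * (real m + 2)"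
      using uv by (intro mult_right_mono power_mono) auto
    also have "\<dots> \<le> (real m + 11/6)\<^sup>2 * (real m + 1)"
    proof -
      have "(real m + 11/6)\<^sup>2 * (real m + 1) - (real m + 7/6)\<^sup>2 * (real m + 2) =
          real m * real m / 3 + real m + 23 / 36"
        by (simp add: power2_eq_square field_simps)
      also have "\<dots> \<ge> 0" by simp
      finally show ?thesis by simp
    qed
    also have "\<dots> \<le> v\<^sup>2 * (real m + 1)"
      using uv by (intro mult_right_mono power_mono) auto
    finally have "u\<^sup>2 * (real m + 2) \<le> v\<^sup>2 * (real m + 1)" .
    then have "(u / v)\<^sup>2 * (real m + 2) \<le> real m + 1"
      using uv by (simp add: power_divide field_simps)
    then have "(U m)\<^sup>2 * ((u / v)\<^sup>2 * (real m + 2)) \<le> (U m)\<^sup>2 * (real m + 1)"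
      by (intro mult_left_mono) auto
    moreover have "U (Suc m) = U m * (u / v)"
      by (simp add: U_def u_def v_def pochhammer_Suc algebra_simps)
    ultimately show ?thesis
      by (simp only: power_mult_distrib mult.assoc)
  qed
  have bound: "(U m)\<^sup>2 * (real m + 1) \<le> (U 0)\<^sup>2" for m
  proof (induction m)
    case (Suc m)
    have "real (Suc m) + 1 = real m + 2" by simp
    then show ?case using step[of m] Suc.IH by (simp only:)
  qed simp
  have "U m \<le> U 0 / sqrt (real m + 1)" for m
  proof -
    have "U m * sqrt (real m + 1) \<le> U 0"
    proof (rule power2_le_imp_le)
      show "(U m * sqrt (real m + 1))\<^sup>2 \<le> (U 0)\<^sup>2"
        using bound[of m] by (simp only: power_mult_distrib real_sqrt_pow2_iff of_nat_0_le_iff add_nonneg_nonneg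
            real_sqrt_pow2 zero_le_one)
    qed (rule U0)
    then show ?thesis
      by (subst pos_le_divide_eq) auto
  qed
  moreover have "(\<lambda>m. U 0 / sqrt (real m + 1)) \<longlonglongrightarrow> 0"
    by real_asymp
  ultimately have "U \<longlonglongrightarrow> 0"
    using U0 by (intro tendsto_sandwich[OF _ _ tendsto_const[of 0], of U]) auto
  then show ?thesis
    unfolding U_def .
qed

text \<open>The sum over \<open>m\<close> of the same terms, telescoping because
  \<open>(1 - x + m + k + 1) - (1 + y + m) = k + 1 - x - y\<close> does not depend on
  \<open>m\<close>. The limit at infinity is controlled by the case \<open>k = 0\<close>.\<close>

lemma pochhammer_quotient_telescope':
  fixes x y :: real
  assumes "0 \<le> x" "x \<le> 1/6" "0 \<le> y" "y \<le> 1/6"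
  shows "(\<lambda>m. pochhammer (1 + y) m * pochhammer (1 - x) k / pochhammer (1 - x) (m + k + 2))
    sums (1 / ((real k + 1 - x) * (real k + 1 - x - y)))"
proof -
  define U where "U m = pochhammer (1 + y) m / pochhammer (1 - x) (m + k + 1)" for m
  have pos: "pochhammer (1 - x) m > 0" "pochhammer (1 + y) m > 0" for m
    by (rule pochhammer_pos; use assms in auto)+
  have "U m \<le> pochhammer (1 + y) m / pochhammer (1 - x) (m + 1)" for m
  proof -
    have "1 \<le> pochhammer (1 - x + real (m + 1)) k"
      unfolding pochhammer_prod by (rule prod_ge_1) (use assms in auto)
    then have "pochhammer (1 - x) (m + 1) * 1 \<le> pochhammer (1 - x) (m + 1 + k)"
      unfolding pochhammer_product'[of "1 - x" "m + 1" k]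
      using pos(1)[of "m + 1"] by (intro mult_left_mono) auto
    then show ?thesis
      unfolding U_def using pos(1)[of "m + 1"] pos(1)[of "m + k + 1"] pos(2)[of m]
      by (intro divide_left_mono) (auto simp: add_ac)
  qed
  then have "U \<longlonglongrightarrow> 0"
    using pos
    by (intro tendsto_sandwich[OF _ _ tendsto_const[of 0] pochhammer_quotient_tendsto_0[OF assms]])
       (auto simp: U_def less_imp_le)
  then have "(\<lambda>m. U m - U (Suc m)) sums (U 0 - 0)"
    by (rule telescope_sums')
  moreover have "U m - U (Suc m) =
      (real k + 1 - x - y) * (pochhammer (1 + y) m / pochhammer (1 - x) (m + k + 2))" for m
  proof -
    have "U m = pochhammer (1 + y) m * (1 - x + real (m + k + 1)) / pochhammer (1 - x) (m + k + 2)"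
      using pos(1)[of "m + k + 1"] assms by (simp add: U_def pochhammer_Suc divide_simps)
    moreover have "U (Suc m) = pochhammer (1 + y) m * (1 + y + real m) / pochhammer (1 - x) (m + k + 2)"
      by (simp add: U_def pochhammer_Suc)
    ultimately show ?thesis
      by (simp add: diff_divide_distrib[symmetric] algebra_simps)
  qed
  ultimately have "(\<lambda>m. (real k + 1 - x - y) * (pochhammer (1 + y) m / pochhammer (1 - x) (m + k + 2)))
      sums U 0"
    by simp
  from sums_mult[OF this, of "pochhammer (1 - x) k / (real k + 1 - x - y)"]
  have "(\<lambda>m. pochhammer (1 + y) m * pochhammer (1 - x) k / pochhammer (1 - x) (m + k + 2))
    sums (pochhammer (1 - x) k / (real k + 1 - x - y) * U 0)"
    using assms by (simp add: mult_ac)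
  also have "pochhammer (1 - x) k / (real k + 1 - x - y) * U 0 =
      1 / ((real k + 1 - x) * (real k + 1 - x - y))"
  proof -
    have "1 - x + real k = real k + 1 - x" "pochhammer (1 - x) k \<noteq> 0"
      using pos(1)[of k] by auto
    then show ?thesis by (simp add: U_def pochhammer_Suc)
  qed
  finally show ?thesis .
qed

lemma summable_shifted_squares:
  fixes x y :: real
  assumes "0 \<le> x" "x \<le> 1/6" "0 \<le> y" "y \<le> 1/6"
  shows "summable (\<lambda>k. 1 / ((real k + 1 - x) * (real k + 1 - x - y)))"
proof (rule summable_comparison_test)
  show "summable (\<lambda>k. 9 / 4 * (1 / (real k + 1)\<^sup>2))"
    using inverse_squares_sums by (intro summable_mult) (auto simp: sums_iff add_ac)
  have "1 / ((real k + 1 - x) * (real k + 1 - x - y)) \<le> 9 / 4 * (1 / (real k + 1)\<^sup>2)" for k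
  proof -
    \<comment> \<open>The constant 9/4 is the inverse square of 2/3, as
      \<open>x + y \<le> 1/3 \<le> (k + 1) / 3\<close>.\<close>
    have "(2/3 * (real k + 1)) * (2/3 * (real k + 1)) \<le> (real k + 1 - x) * (real k + 1 - x - y)"
      using assms by (intro mult_mono) auto
    then show ?thesis
      using assms by (simp add: power2_eq_square divide_simps) (auto simp: field_simps)
  qed
  then show "\<exists>N. \<forall>n\<ge>N. norm (1 / ((real n + 1 - x) * (real n + 1 - x - y))) \<le> 9 / 4 * (1 / (real n + 1)\<^sup>2)"
    using assms by (intro exI[of _ 0]) auto
qed

text \<open>Both inner sums of one nonnegative double series telescope, so exchanging them equates
  the two outer series. The indices \<open>m\<close> and \<open>k\<close> are shifted to start at
  0.\<close>

lemma pochhammer_quotient_series: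
  fixes x y :: real
  assumes "0 \<le> x" "x \<le> 1/6" "0 \<le> y" "y \<le> 1/6"
  shows "(\<lambda>m. pochhammer (1 + y) m / ((real m + 1) * pochhammer (1 - x) (m + 1)))
    sums (suminf (\<lambda>k. 1 / ((real k + 1 - x) * (real k + 1 - x - y))))"
proof -
  have pos: "pochhammer (1 - x) m > 0" "pochhammer (1 + y) m > 0" for m
    by (rule pochhammer_pos; use assms in auto)+
  have "(\<lambda>m. suminf (\<lambda>k. pochhammer (1 + y) m * pochhammer (1 - x) k / pochhammer (1 - x) (m + k + 2)))
    sums (suminf (\<lambda>k. 1 / ((real k + 1 - x) * (real k + 1 - x - y))))"
    by (rule sums_swap_nonneg(2)[OF _ pochhammer_quotient_telescope'[OF assms]
          summable_sums[OF summable_shifted_squares[OF assms]]])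
       (use pos in \<open>simp add: less_imp_le\<close>)
  moreover have "(suminf (\<lambda>k. pochhammer (1 + y) m * pochhammer (1 - x) k / pochhammer (1 - x) (m + k + 2))) =
      pochhammer (1 + y) m / ((real m + 1) * pochhammer (1 - x) (m + 1))" for m
    using sums_mult[OF pochhammer_quotient_telescope[of x m], of "pochhammer (1 + y) m"] assms
    by (simp add: sums_iff)
  ultimately show ?thesis by simp
qed

section \<open>Truncated multiple zeta values\<close>

text \<open>The summation variables satisfy \<open>p < m_1 < ... < m_d < M\<close>. The free lower
  bound makes peeling off the smallest variable a recursion on the index, and also describes the
  variables beyond a fixed middle one.\<close>

fun trunc_mzv :: "nat \<Rightarrow> nat \<Rightarrow> nat list \<Rightarrow> real" where
  "trunc_mzv p M [] = 1"
| "trunc_mzv p M (k # ks) = (\<Sum>m\<in>{p<..<M}. trunc_mzv m M ks / real m ^ k)"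

declare trunc_mzv.simps(2) [simp del]

lemma trunc_mzv_nonneg: "0 \<le> trunc_mzv p M ks"
  by (induction ks arbitrary: p) (auto simp: trunc_mzv.simps intro!: sum_nonneg)

text \<open>The terms are grouped by the value \<open>m\<close> of the variable belonging to
  \<open>k\<close>: the variables before it lie below \<open>m\<close>, those after it
  above.\<close>

lemma trunc_mzv_append:
  "trunc_mzv p M (ks @ k # ls) =
    (\<Sum>m\<in>{p<..<M}. trunc_mzv p m ks * trunc_mzv m M ls / real m ^ k)"
proof (induction ks arbitrary: p)
  case Nil
  then show ?case by (simp add: trunc_mzv.simps)
next
  case (Cons j ks)
  have "trunc_mzv p M ((j # ks) @ k # ls) =
      (\<Sum>q\<in>{p<..<M}. \<Sum>m\<in>{q<..<M}. trunc_mzv q m ks / real q ^ j * (trunc_mzv m M ls / real m ^ k))"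
    by (simp add: trunc_mzv.simps Cons.IH sum_divide_distrib mult_ac)
  also have "\<dots> = (\<Sum>m\<in>{p<..<M}. \<Sum>q\<in>{p<..<m}. trunc_mzv q m ks / real q ^ j * (trunc_mzv m M ls / real m ^ k))"
    unfolding sum.Sigma[OF finite_greaterThanLessThan ballI[OF finite_greaterThanLessThan]]
    by (rule sum.reindex_bij_witness[of _ "\<lambda>(m, q). (q, m)" "\<lambda>(q, m). (m, q)"]) auto
  also have "\<dots> = (\<Sum>m\<in>{p<..<M}. trunc_mzv p m (j # ks) * trunc_mzv m M ls / real m ^ k)"
    by (simp add: trunc_mzv.simps sum_distrib_left sum_distrib_right sum_divide_distrib mult_ac)
  finally show ?case .
qed

lemma trunc_mzv_snoc_Suc:
  "trunc_mzv 0 (Suc (Suc m)) (ks @ [k]) =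
    trunc_mzv 0 (Suc m) (ks @ [k]) + trunc_mzv 0 (Suc m) ks / real (Suc m) ^ k"
proof -
  have "{0<..<Suc (Suc m)} = insert (Suc m) {0<..<Suc m}" by auto
  then show ?thesis by (simp add: trunc_mzv_append)
qed

section \<open>Generating functions for strings of ones\<close>

definition trunc_ones_fps :: "nat \<Rightarrow> nat \<Rightarrow> real fps" where
  "trunc_ones_fps p M = Abs_fps (\<lambda>c. trunc_mzv p M (replicate c 1))"

lemma fps_nth_trunc_ones_fps [simp]:
  "fps_nth (trunc_ones_fps p M) c = trunc_mzv p M (replicate c 1)"
  by (simp add: trunc_ones_fps_def)

text \<open>Makes \<open>trunc_ones_fps p M\<close> the product of \<open>1 + X/n\<close> over
  \<open>p < n < M\<close>: the smallest variable either is \<open>p + 1\<close> or exceeds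
  it.\<close>

lemma trunc_ones_fps_rec:
  assumes "Suc p < M"
  shows "trunc_ones_fps p M = (1 + fps_const (1 / real (Suc p)) * fps_X) * trunc_ones_fps (Suc p) M"
proof (rule fps_ext)
  fix c
  have "{p<..<M} = insert (Suc p) {Suc p<..<M}" using assms by auto
  then show "fps_nth (trunc_ones_fps p M) c =
      fps_nth ((1 + fps_const (1 / real (Suc p)) * fps_X) * trunc_ones_fps (Suc p) M) c"
    by (cases c) (simp_all add: trunc_mzv.simps distrib_right mult.assoc)
qed

lemma trunc_ones_fps_self: "M \<le> Suc p \<Longrightarrow> trunc_ones_fps p M = 1"
proof (rule fps_ext)
  fix c assume "M \<le> Suc p"
  then have "{p<..<M} = {}" by auto
  then show "fps_nth (trunc_ones_fps p M) c = fps_nth 1 c"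
    by (cases c) (simp_all add: trunc_mzv.simps)
qed

text \<open>The upper bound is exclusive, so \<open>Suc m\<close> places the factor of
  \<open>m\<close> in the first product.\<close>

lemma trunc_ones_fps_split:
  assumes "p \<le> m" "m < M"
  shows "trunc_ones_fps p M = trunc_ones_fps p (Suc m) * trunc_ones_fps m M"
  using assms
proof (induction "m - p" arbitrary: p)
  case 0
  then show ?case by (simp add: trunc_ones_fps_self)
next
  case (Suc n)
  then have "trunc_ones_fps (Suc p) M = trunc_ones_fps (Suc p) (Suc m) * trunc_ones_fps m M"
    by (intro Suc.hyps(1)) auto
  moreover have "Suc p < M" "Suc p < Suc m" using Suc by auto
  ultimately show ?case
    by (simp add: trunc_ones_fps_rec mult.assoc)
qed

text \<open>The complete homogeneous symmetric polynomial of degree \<open>j\<close> in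
  \<open>1, 1/2, ..., 1/m\<close>.\<close>

fun complete_hom :: "nat \<Rightarrow> nat \<Rightarrow> real" where
  "complete_hom 0 j = (if j = 0 then 1 else 0)"
| "complete_hom (Suc m) j = (\<Sum>i\<le>j. complete_hom m i * (1 / real (Suc m)) ^ (j - i))"

declare complete_hom.simps(2) [simp del]

lemma complete_hom_nonneg: "0 \<le> complete_hom m j"
  by (induction m arbitrary: j) (auto simp: complete_hom.simps intro!: sum_nonneg)

lemma complete_hom_0_right [simp]: "complete_hom m 0 = 1"
  by (induction m) (auto simp: complete_hom.simps)

text \<open>The classical relation between elementary and complete symmetric functions: each new
  variable multiplies one series by \<open>1 + X/(m + 1)\<close> and the other by the geometric
  series inverse to it.\<close>

lemma complete_hom_inverse:
  "Abs_fps (\<lambda>j. (-1) ^ j * complete_hom m j) * trunc_ones_fps 0 (Suc m) = 1"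
proof (induction m)
  case 0
  have "Abs_fps (\<lambda>j. (-1) ^ j * complete_hom 0 j) = 1"
    by (rule fps_ext) simp
  then show ?case by (simp add: trunc_ones_fps_self)
next
  case (Suc m)
  define G where "G = Abs_fps (\<lambda>j. (- (1 / real (Suc m))) ^ j)"
  have "Abs_fps (\<lambda>j. (-1) ^ j * complete_hom (Suc m) j) = Abs_fps (\<lambda>j. (-1) ^ j * complete_hom m j) * G"
  proof (rule fps_ext)
    fix j
    have "(-1) ^ j * (complete_hom m i * (1 / real (Suc m)) ^ (j - i)) =
        (-1) ^ i * complete_hom m i * (- (1 / real (Suc m))) ^ (j - i)" if "i \<le> j" for i
    proof -
      have "(-1 :: real) ^ j = (-1) ^ i * (-1) ^ (j - i)"
        using that by (simp flip: power_add)
      then show ?thesis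
        unfolding power_minus[of "1 / real (Suc m)"] by (simp only: mult_ac)
    qed
    then show "fps_nth (Abs_fps (\<lambda>j. (-1) ^ j * complete_hom (Suc m) j)) j =
        fps_nth (Abs_fps (\<lambda>j. (-1) ^ j * complete_hom m j) * G) j"
      unfolding fps_mult_nth G_def fps_nth_Abs_fps complete_hom.simps sum_distrib_left
      by (simp only: atMost_atLeast0) (intro sum.cong; simp)
  qed
  moreover have "trunc_ones_fps 0 (Suc (Suc m)) =
      trunc_ones_fps 0 (Suc m) * (1 + fps_const (1 / real (Suc m)) * fps_X)"
    using trunc_ones_fps_split[of 0 m "Suc (Suc m)"] trunc_ones_fps_rec[of m "Suc (Suc m)"]
    by (simp add: trunc_ones_fps_self)
  moreover have "G * (1 + fps_const (1 / real (Suc m)) * fps_X) = 1"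
  proof (rule fps_ext)
    fix j
    have "G * (1 + fps_const (1 / real (Suc m)) * fps_X) = G + fps_const (1 / real (Suc m)) * (G * fps_X)"
      by (simp only: distrib_left mult_1_right mult.left_commute)
    then show "fps_nth (G * (1 + fps_const (1 / real (Suc m)) * fps_X)) j = fps_nth 1 j"
      by (cases j) (simp_all add: G_def)
  qed
  moreover have "(A * G) * (T * F) = (A * T) * (G * F)" for A T F :: "real fps"
    by (simp only: mult_ac)
  ultimately show ?case
    using Suc by (simp only: mult_1_left)
qed

text \<open>The factor \<open>(-1) ^ j * complete_hom m j\<close> takes the place of the trailing
  ones. It involves \<open>m\<close> only, so that \<open>M\<close> merely bounds a series in
  \<open>m\<close>.\<close>

definition tail_sum :: "nat \<Rightarrow> nat \<Rightarrow> nat \<Rightarrow> real" where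
  "tail_sum M a j = (\<Sum>m\<in>{0<..<M}. trunc_mzv 0 m (replicate a 1) * ((-1) ^ j * complete_hom m j) / real m ^ 2)"

text \<open>The product over \<open>m < n < M\<close> is the product over \<open>n < M\<close>
  divided by the one over \<open>n \<le> m\<close>; the former does not depend on \<open>m\<close>
  and comes out of the sum.\<close>

lemma trunc_mzv_ones_two_ones:
  "trunc_mzv 0 M (replicate a 1 @ 2 # replicate c 1) =
    (\<Sum>s\<le>c. trunc_mzv 0 M (replicate s 1) * tail_sum M a (c - s))"
proof -
  have coeff: "trunc_mzv m M (replicate c 1) =
      (\<Sum>s\<le>c. trunc_mzv 0 M (replicate s 1) * ((-1) ^ (c - s) * complete_hom m (c - s)))"
    if "m < M" for m
  proof -
    have "trunc_ones_fps 0 M * Abs_fps (\<lambda>j. (-1) ^ j * complete_hom m j) =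
        (Abs_fps (\<lambda>j. (-1) ^ j * complete_hom m j) * trunc_ones_fps 0 (Suc m)) * trunc_ones_fps m M"
      using trunc_ones_fps_split[of 0 m M] that by (simp add: mult_ac)
    then have "trunc_ones_fps m M = trunc_ones_fps 0 M * Abs_fps (\<lambda>j. (-1) ^ j * complete_hom m j)"
      by (simp only: complete_hom_inverse mult_1_left)
    from arg_cong[OF this, of "\<lambda>F. fps_nth F c"] show ?thesis
      by (simp add: fps_mult_nth atMost_atLeast0)
  qed
  have "trunc_mzv 0 M (replicate a 1 @ 2 # replicate c 1) =
      (\<Sum>m\<in>{0<..<M}. \<Sum>s\<le>c. trunc_mzv 0 M (replicate s 1) *
        (trunc_mzv 0 m (replicate a 1) * ((-1) ^ (c - s) * complete_hom m (c - s)) / real m ^ 2))"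
    unfolding trunc_mzv_append
    by (intro sum.cong refl) (simp add: coeff sum_distrib_left sum_distrib_right sum_divide_distrib mult_ac del: One_nat_def)
  also have "\<dots> = (\<Sum>s\<le>c. trunc_mzv 0 M (replicate s 1) * tail_sum M a (c - s))"
    by (subst sum.swap) (simp add: tail_sum_def sum_distrib_left)
  finally show ?thesis .
qed

section \<open>Evaluation of the tail series\<close>

lemma trunc_ones_power_series:
  "(\<lambda>a. trunc_mzv 0 (Suc m) (replicate a 1) * y ^ a) sums (pochhammer (1 + y) m / fact m)"
proof (induction m)
  case 0
  have "trunc_mzv 0 (Suc 0) (replicate a 1) * y ^ a = (if a = 0 then 1 else 0)" for a
    by (cases a) (simp_all add: trunc_mzv.simps)
  then show ?case
    using sums_single[of 0 "\<lambda>_. 1::real"] by simp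
next
  case (Suc m)
  let ?e = "\<lambda>m a. trunc_mzv 0 m (replicate a 1)"
  let ?P = "pochhammer (1 + y) m / fact m"
  have rec: "?e (Suc (Suc m)) (Suc a) = ?e (Suc m) (Suc a) + ?e (Suc m) a / real (Suc m)" for a
    using trunc_mzv_snoc_Suc[of m "replicate a 1" 1] by (simp add: replicate_append_same del: One_nat_def)
  have "(\<lambda>a. ?e (Suc m) (Suc a) * y ^ Suc a) sums (?P - 1)"
    using Suc.IH by (subst sums_Suc_iff) simp
  moreover have "(\<lambda>a. ?e (Suc m) a * y ^ a * (y / real (Suc m))) sums (?P * (y / real (Suc m)))"
    by (intro sums_mult2 Suc.IH)
  ultimately have "(\<lambda>a. ?e (Suc m) (Suc a) * y ^ Suc a + ?e (Suc m) a * y ^ a * (y / real (Suc m)))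
      sums (?P - 1 + ?P * (y / real (Suc m)))"
    by (rule sums_add)
  moreover have "?e (Suc m) (Suc a) * y ^ Suc a + ?e (Suc m) a * y ^ a * (y / real (Suc m)) =
      ?e (Suc (Suc m)) (Suc a) * y ^ Suc a" for a
    unfolding rec by (simp add: distrib_right)
  ultimately have "(\<lambda>a. ?e (Suc (Suc m)) (Suc a) * y ^ Suc a) sums (?P - 1 + ?P * (y / real (Suc m)))"
    by (simp only:)
  then have "(\<lambda>a. ?e (Suc (Suc m)) a * y ^ a) sums (?P + ?P * (y / real (Suc m)))"
    by (subst (asm) sums_Suc_iff) simp
  moreover have "?P + ?P * (y / real (Suc m)) = pochhammer (1 + y) (Suc m) / fact (Suc m)"
    by (simp add: pochhammer_Suc divide_simps) (simp add: algebra_simps)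
  ultimately show ?case by (simp only:)
qed

text \<open>The product of \<open>1 / (1 - x/n)\<close> over \<open>n \<le> m\<close>, built up by
  Cauchy products with geometric series. The unsigned coefficients keep all terms nonnegative, which
  is why \<open>x\<close> stands in place of \<open>- x\<close>.\<close>

lemma complete_hom_power_series:
  fixes x :: real
  assumes x: "0 \<le> x" "x < 1"
  shows "(\<lambda>j. complete_hom m j * x ^ j) sums (fact m / pochhammer (1 - x) m)"
proof (induction m)
  case 0
  have "complete_hom 0 j * x ^ j = (if j = 0 then 1 else 0)" for j
    by simp
  then show ?case
    using sums_single[of 0 "\<lambda>_. 1::real"] by (simp only: pochhammer_0 fact_0 div_by_1)
next
  case (Suc m)
  let ?a = "\<lambda>i. complete_hom m i * x ^ i"
  let ?b = "\<lambda>i. (x / real (Suc m)) ^ i"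
  have lt: "x / real (Suc m) < 1"
    using x by (simp add: divide_simps)
  have b: "?b sums (1 / (1 - x / real (Suc m)))"
    by (rule geometric_sums) (use x lt in auto)
  have "(\<lambda>j. \<Sum>i\<le>j. ?a i * ?b (j - i)) sums (suminf ?a * suminf ?b)"
    by (rule Cauchy_product_sums)
      (use Suc.IH b x in \<open>simp_all add: sums_iff complete_hom_nonneg abs_mult abs_of_nonneg\<close>)
  moreover have "(\<Sum>i\<le>j. ?a i * ?b (j - i)) = complete_hom (Suc m) j * x ^ j" for j
  proof -
    have eq: "?a i * ?b (j - i) = complete_hom m i * (1 / real (Suc m)) ^ (j - i) * x ^ j"
      if "i \<le> j" for i
    proof -
      have "x ^ j = x ^ i * x ^ (j - i)"
        using that by (simp flip: power_add)
      then show ?thesis by (simp add: power_divide)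
    qed
    show ?thesis
      unfolding complete_hom.simps sum_distrib_right by (intro sum.cong refl eq) simp
  qed
  moreover have "suminf ?a * suminf ?b = fact (Suc m) / pochhammer (1 - x) (Suc m)"
  proof -
    have "pochhammer (1 - x) m > 0"
      by (rule pochhammer_pos) (use x in auto)
    moreover have "suminf ?a = fact m / pochhammer (1 - x) m" "suminf ?b = 1 / (1 - x / real (Suc m))"
      using Suc.IH b by (simp_all add: sums_iff)
    moreover have "1 - x / real (Suc m) = (1 - x + real m) / real (Suc m)"
      by (simp add: field_simps)
    ultimately show ?thesis
      using x by (simp add: pochhammer_Suc)
  qed
  ultimately show ?case by (simp only:)
qed

text \<open>Each Cauchy product with the geometric series raises the exponent by one, and the
  coefficients add up by the hockey-stick identity.\<close>

lemma negative_binomial_sums: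
  fixes t :: real
  assumes t: "0 \<le> t" "t < 1"
  shows "(\<lambda>j. real ((n + j) choose j) * t ^ j) sums (1 / (1 - t) ^ Suc n)"
proof (induction n)
  case 0
  then show ?case using geometric_sums[of t] t by simp
next
  case (Suc n)
  have geo: "(\<lambda>j. t ^ j) sums (1 / (1 - t))"
    using geometric_sums[of t] t by simp
  have "(\<lambda>j. \<Sum>i\<le>j. real ((n + i) choose i) * t ^ i * t ^ (j - i)) sums
      (suminf (\<lambda>j. real ((n + j) choose j) * t ^ j) * suminf (\<lambda>j. t ^ j))"
    by (rule Cauchy_product_sums)
      (use Suc.IH geo t in \<open>simp_all add: sums_iff abs_mult abs_of_nonneg\<close>)
  moreover have "(\<Sum>i\<le>j. real ((n + i) choose i) * t ^ i * t ^ (j - i)) =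
      real ((Suc n + j) choose j) * t ^ j" for j
  proof -
    have "(\<Sum>i\<le>j. real ((n + i) choose i) * t ^ i * t ^ (j - i)) =
        (\<Sum>i\<le>j. real ((n + i) choose i) * t ^ j)"
      by (intro sum.cong refl) (simp add: mult.assoc flip: power_add)
    also have "\<dots> = real (\<Sum>i\<le>j. (n + i) choose i) * t ^ j"
      by (simp add: sum_distrib_right)
    finally show ?thesis
      by (simp add: sum_choose_lower)
  qed
  ultimately show ?case
    using Suc.IH geo by (simp add: sums_iff)
qed

text \<open>Comparison of the coefficients of \<open>y ^ a\<close> in
  \<open>pochhammer_quotient_series\<close>, with \<open>x\<close> kept fixed.\<close>

lemma tail_series_coeff_a:
  fixes x :: real
  assumes x: "0 \<le> x" "x \<le> 1/6"
  shows "(\<lambda>m. trunc_mzv 0 (Suc m) (replicate a 1) * (fact (Suc m) / pochhammer (1 - x) (Suc m)) / (real m + 1) ^ 2)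
      sums suminf (\<lambda>k. 1 / (real k + 1 - x) ^ (a + 2))"
    and "summable (\<lambda>k. 1 / (real k + 1 - x) ^ (a + 2))"
proof -
  have pos: "pochhammer (1 - x) m > 0" for m
    by (rule pochhammer_pos) (use x in auto)
  \<comment> \<open>This weight turns the generating function
    \<open>pochhammer (1 + y) m / fact m\<close> into the \<open>m\<close>-th term of
    \<open>pochhammer_quotient_series\<close>.\<close>
  define c where "c m = fact (Suc m) / pochhammer (1 - x) (Suc m) / (real m + 1) ^ 2" for m
  have c0: "c m > 0" for m
    using pos[of "Suc m"] by (simp add: c_def del: fact_Suc)
  let ?A = "\<lambda>a. suminf (\<lambda>m. trunc_mzv 0 (Suc m) (replicate a 1) * c m)"
  let ?B = "\<lambda>a. suminf (\<lambda>k. 1 / (real k + 1 - x) ^ (a + 2))"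
  have main: "summable (\<lambda>m. trunc_mzv 0 (Suc m) (replicate a 1) * c m) \<and>
      summable (\<lambda>k. 1 / (real k + 1 - x) ^ (a + 2)) \<and>
      (\<exists>S. (\<lambda>a. ?A a * y ^ a) sums S \<and> (\<lambda>a. ?B a * y ^ a) sums S)"
    if y: "0 < y" "y < 1/6" for y a
  proof -
    let ?S = "suminf (\<lambda>k. 1 / ((real k + 1 - x) * (real k + 1 - x - y)))"
    let ?f = "\<lambda>m a. trunc_mzv 0 (Suc m) (replicate a 1) * c m * y ^ a"
    let ?g = "\<lambda>k a. 1 / (real k + 1 - x) ^ (a + 2) * y ^ a"
    have f0: "0 \<le> ?f m a" for m a
      using y c0[of m] trunc_mzv_nonneg[of 0 "Suc m"] by simp
    have g0: "0 \<le> ?g k a" for k a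
      using x y by simp
    have frow: "?f m sums (pochhammer (1 + y) m / ((real m + 1) * pochhammer (1 - x) (m + 1)))" for m
    proof -
      have "pochhammer (1 + y) m / fact m * c m =
          pochhammer (1 + y) m / ((real m + 1) * pochhammer (1 - x) (m + 1))"
        using pos[of "Suc m"] unfolding c_def
        by (simp add: power2_eq_square divide_simps add_ac)
      then show ?thesis
        using sums_mult2[OF trunc_ones_power_series[of m y], of "c m"] by (simp add: mult_ac)
    qed
    have grow: "?g k sums (1 / ((real k + 1 - x) * (real k + 1 - x - y)))" for k
    proof -
      define z where "z = real k + 1 - x"
      have z: "0 < z" "y < z" using x y by (auto simp: z_def)
      have "(\<lambda>a. (y / z) ^ a / z ^ 2) sums (1 / (1 - y / z) / z ^ 2)"
        by (intro sums_divide geometric_sums) (use z y in auto)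
      moreover have "1 / (1 - y / z) / z ^ 2 = 1 / (z * (z - y))"
        using z by (simp add: field_simps power2_eq_square)
      moreover have "(y / z) ^ a / z ^ 2 = 1 / z ^ (a + 2) * y ^ a" for a
        by (simp add: power_divide power_add power2_eq_square)
      ultimately show ?thesis
        by (simp add: z_def)
    qed
    have x': "0 \<le> x" "x \<le> 1/6" "0 \<le> y" "y \<le> 1/6"
      using x y by auto
    note f = sums_swap_nonneg[OF f0 frow pochhammer_quotient_series[OF x']]
    note g = sums_swap_nonneg[OF g0 grow summable_sums[OF summable_shifted_squares[OF x']]]
    \<comment> \<open>Convergence of the coefficient series comes out of the interchange, after
      cancelling \<open>y ^ a > 0\<close>.\<close>
    have fs: "summable (\<lambda>m. trunc_mzv 0 (Suc m) (replicate a 1) * c m)" for a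
      using summable_divide[OF f(1)[of a], of "y ^ a"] y by simp
    have gs: "summable (\<lambda>k. 1 / (real k + 1 - x) ^ (a + 2))" for a
      using summable_divide[OF g(1)[of a], of "y ^ a"] y by simp
    have "(\<lambda>a. ?A a * y ^ a) sums ?S"
      using f(2) by (subst suminf_mult2[OF fs])
    moreover have "(\<lambda>a. ?B a * y ^ a) sums ?S"
      using g(2) by (subst suminf_mult2[OF gs])
    ultimately show ?thesis
      using fs gs by blast
  qed
  have "?A = ?B"
    by (rule powser_unique_right[of "1/6"]) (use main in auto)
  then have "?A a = ?B a" by (rule fun_cong)
  \<comment> \<open>Any \<open>y\<close> between 0 and 1/6 yields this; 1/12 is an arbitrary
    choice.\<close>
  moreover have "summable (\<lambda>m. trunc_mzv 0 (Suc m) (replicate a 1) * c m)"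
    using main[of "1/12"] by simp
  ultimately have "(\<lambda>m. trunc_mzv 0 (Suc m) (replicate a 1) * c m) sums ?B a"
    by (metis summable_sums)
  then show "(\<lambda>m. trunc_mzv 0 (Suc m) (replicate a 1) * (fact (Suc m) / pochhammer (1 - x) (Suc m)) / (real m + 1) ^ 2)
      sums ?B a"
    by (simp only: c_def times_divide_eq_right)
  show "summable (\<lambda>k. 1 / (real k + 1 - x) ^ (a + 2))"
    using main[of "1/12"] by simp
qed

text \<open>The same comparison for the powers of \<open>x\<close>, starting from the identity just
  obtained. Expanding \<open>1 / (k + 1 - x) ^ (a + 2)\<close> by the negative binomial series
  produces the binomial coefficient and \<open>\<zeta>(a + j + 2)\<close>.\<close>

theorem tail_series:
  "(\<lambda>m. trunc_mzv 0 (Suc m) (replicate a 1) * complete_hom (Suc m) j / (real m + 1) ^ 2)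
    sums (real ((a + j + 1) choose j) * suminf (\<lambda>k. 1 / (real k + 1) ^ (a + j + 2)))"
proof -
  define e where "e m = trunc_mzv 0 (Suc m) (replicate a 1) / (real m + 1) ^ 2" for m
  have e0: "e m \<ge> 0" for m
    by (simp add: e_def trunc_mzv_nonneg)
  let ?A = "\<lambda>j. suminf (\<lambda>m. e m * complete_hom (Suc m) j)"
  let ?b = "\<lambda>j k. real ((a + 1 + j) choose j) * (1 / (real k + 1) ^ (a + j + 2))"
  let ?B = "\<lambda>j. suminf (?b j)"
  have main: "summable (\<lambda>m. e m * complete_hom (Suc m) j) \<and>
      (\<exists>S. (\<lambda>j. ?A j * x ^ j) sums S \<and> (\<lambda>j. ?B j * x ^ j) sums S)"
    if x: "0 < x" "x < 1/6" for x j
  proof -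
    let ?S = "suminf (\<lambda>k. 1 / (real k + 1 - x) ^ (a + 2))"
    let ?f = "\<lambda>m j. e m * complete_hom (Suc m) j * x ^ j"
    let ?g = "\<lambda>k j. ?b j k * x ^ j"
    have x': "0 \<le> x" "x \<le> 1/6" "x < 1" using x by auto
    have f0: "0 \<le> ?f m j" for m j
      using x e0 complete_hom_nonneg by simp
    have g0: "0 \<le> ?g k j" for k j
      using x by simp
    have frow: "?f m sums (e m * (fact (Suc m) / pochhammer (1 - x) (Suc m)))" for m
      using sums_mult[OF complete_hom_power_series[of x "Suc m"], of "e m"] x'
      by (simp only: mult.assoc)
    have grow: "?g k sums (1 / (real k + 1 - x) ^ (a + 2))" for k
    proof -
      define z where "z = real k + 1"
      have z: "1 \<le> z" "x < z" using x by (auto simp: z_def)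
      have "(\<lambda>j. real ((a + 1 + j) choose j) * (x / z) ^ j / z ^ (a + 2)) sums
          (1 / (1 - x / z) ^ Suc (a + 1) / z ^ (a + 2))"
        by (intro sums_divide negative_binomial_sums) (use z x in auto)
      moreover have "1 / (1 - x / z) ^ Suc (a + 1) / z ^ (a + 2) = 1 / (z - x) ^ (a + 2)"
      proof -
        have "(1 - x / z) ^ (a + 2) * z ^ (a + 2) = (z - x) ^ (a + 2)"
          using z by (simp add: field_simps flip: power_mult_distrib)
        then show ?thesis by simp
      qed
      moreover have "real ((a + 1 + j) choose j) * (x / z) ^ j / z ^ (a + 2) =
          real ((a + 1 + j) choose j) * (1 / z ^ (a + j + 2)) * x ^ j" for j
        by (simp add: power_divide power_add)
      ultimately show ?thesis
        by (simp only: z_def)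
    qed
    have "(\<lambda>m. e m * (fact (Suc m) / pochhammer (1 - x) (Suc m))) sums ?S"
      using tail_series_coeff_a(1)[of x a] x' by (simp only: e_def times_divide_eq_left)
    note f = sums_swap_nonneg[OF f0 frow this]
    note g = sums_swap_nonneg[OF g0 grow summable_sums[OF tail_series_coeff_a(2)[OF x'(1,2)]]]
    have fs: "summable (\<lambda>m. e m * complete_hom (Suc m) j)" for j
      using summable_divide[OF f(1)[of j], of "x ^ j"] x by simp
    have gs: "summable (?b j)" for j
      using summable_divide[OF g(1)[of j], of "x ^ j"] x by simp
    have "(\<lambda>j. ?A j * x ^ j) sums ?S"
      using f(2) by (subst suminf_mult2[OF fs])
    moreover have "(\<lambda>j. ?B j * x ^ j) sums ?S"
      using g(2) by (subst suminf_mult2[OF gs])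
    ultimately show ?thesis
      using fs by blast
  qed
  have "?A = ?B"
    by (rule powser_unique_right[of "1/6"]) (use main in auto)
  then have "?A j = ?B j" by (rule fun_cong)
  also have "?B j = real ((a + 1 + j) choose j) * suminf (\<lambda>k. 1 / (real k + 1) ^ (a + j + 2))"
    using tail_series_coeff_a(2)[of 0 "a + j"] by (intro suminf_mult) simp
  finally have "?A j = \<dots>" .
  moreover have "summable (\<lambda>m. e m * complete_hom (Suc m) j)"
    using main[of "1/12" j] by simp
  ultimately have "(\<lambda>m. e m * complete_hom (Suc m) j) sums
      (real ((a + 1 + j) choose j) * suminf (\<lambda>k. 1 / (real k + 1) ^ (a + j + 2)))"
    by (metis summable_sums)
  then show ?thesis
    by (simp only: e_def times_divide_eq_left add_ac)
qed

section \<open>Convergence to multiple zeta values\<close>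

definition increasing_lists :: "nat \<Rightarrow> nat \<Rightarrow> nat \<Rightarrow> nat list set" where
  "increasing_lists p M n =
    {ms. length ms = n \<and> sorted_wrt (<) ms \<and> (\<forall>m\<in>set ms. p < m \<and> m < M)}"

definition mzv_term :: "nat list \<Rightarrow> nat list \<Rightarrow> real" where
  "mzv_term ks ms = (\<Prod>i<length ks. 1 / real (ms ! i) ^ (ks ! i))"

lemma mzv_term_Cons: "mzv_term (k # ks) (m # ms) = mzv_term ks ms / real m ^ k"
  by (simp add: mzv_term_def prod.lessThan_Suc_shift del: prod.lessThan_Suc)

lemma mzv_term_nonneg: "0 \<le> mzv_term ks ms"
  by (simp add: mzv_term_def prod_nonneg)

lemma increasing_lists_0: "increasing_lists p M 0 = {[]}"
  by (auto simp: increasing_lists_def)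

lemma bij_betw_increasing_lists:
  "bij_betw (\<lambda>(m, ms). m # ms) (SIGMA m:{p<..<M}. increasing_lists m M n) (increasing_lists p M (Suc n))"
proof (rule bij_betwI[where g = "\<lambda>ms. (hd ms, tl ms)"])
  show "(\<lambda>ms. (hd ms, tl ms)) \<in> increasing_lists p M (Suc n) \<rightarrow> (SIGMA m:{p<..<M}. increasing_lists m M n)"
  proof
    fix ms assume "ms \<in> increasing_lists p M (Suc n)"
    then show "(hd ms, tl ms) \<in> (SIGMA m:{p<..<M}. increasing_lists m M n)"
      by (cases ms) (auto simp: increasing_lists_def)
  qed
qed (auto simp: increasing_lists_def length_Suc_conv, meson less_trans)

lemma finite_increasing_lists: "finite (increasing_lists p M n)"
proof (induction n arbitrary: p)
  case (Suc n)
  then show ?case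
    using bij_betw_finite[OF bij_betw_increasing_lists[of p M n]] by auto
qed (simp add: increasing_lists_0)

lemma trunc_mzv_eq_sum: "trunc_mzv p M ks = sum (mzv_term ks) (increasing_lists p M (length ks))"
proof (induction ks arbitrary: p)
  case Nil
  then show ?case by (simp add: increasing_lists_0 mzv_term_def)
next
  case (Cons k ks)
  have "trunc_mzv p M (k # ks) =
      (\<Sum>m\<in>{p<..<M}. \<Sum>ms\<in>increasing_lists m M (length ks). mzv_term (k # ks) (m # ms))"
    by (simp add: trunc_mzv.simps Cons.IH mzv_term_Cons sum_divide_distrib)
  also have "\<dots> = (\<Sum>(m, ms)\<in>(SIGMA m:{p<..<M}. increasing_lists m M (length ks)). mzv_term (k # ks) (m # ms))"
    by (rule sum.Sigma) (auto simp: finite_increasing_lists)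
  also have "\<dots> = (\<Sum>ms\<in>increasing_lists p M (Suc (length ks)). mzv_term (k # ks) ms)"
    using sum.reindex_bij_betw[OF bij_betw_increasing_lists[of p M "length ks"], of "mzv_term (k # ks)"]
    by (simp add: case_prod_unfold)
  finally show ?case by simp
qed

lemma trunc_mzv_mono:
  assumes "list_all2 (\<le>) ls ks"
  shows "trunc_mzv p M ks \<le> trunc_mzv p M ls"
  using assms
proof (induction arbitrary: p rule: list_all2_induct)
  case (Cons l ls k ks)
  have "trunc_mzv m M ks / real m ^ k \<le> trunc_mzv m M ls / real m ^ l" if "p < m" for m
    using that Cons
    by (intro frac_le trunc_mzv_nonneg zero_less_power power_increasing) auto
  then show ?case
    unfolding trunc_mzv.simps by (intro sum_mono) simp
qed simp

text \<open>Exhibits the truncations as partial sums of \<open>tail_series\<close> with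
  \<open>j = 0\<close>.\<close>

lemma trunc_ones_two_eq:
  "trunc_mzv 0 (Suc M) (replicate a 1 @ [2]) = (\<Sum>m<M. trunc_mzv 0 (Suc m) (replicate a 1) / (real m + 1) ^ 2)"
proof (induction M)
  case 0
  have "{0<..<Suc 0} = {}" by auto
  then show ?case by (simp add: trunc_mzv_append)
next
  case (Suc M)
  then show ?case
    using trunc_mzv_snoc_Suc[of M "replicate a 1" 2] by (simp add: add_ac)
qed

lemma trunc_mzv_mono_bound: "M \<le> N \<Longrightarrow> trunc_mzv p M ks \<le> trunc_mzv p N ks"
  unfolding trunc_mzv_eq_sum
  by (intro sum_mono2 finite_increasing_lists mzv_term_nonneg) (auto simp: increasing_lists_def)

text \<open>The largest variable belongs to the last entry, so that entry decides
  convergence.\<close>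

definition admissible :: "nat list \<Rightarrow> bool" where
  "admissible ks \<longleftrightarrow> (\<forall>k\<in>set ks. 1 \<le> k) \<and> (ks = [] \<or> 2 \<le> last ks)"

text \<open>Lowering the entries to \<open>({1}^n, 2)\<close> can only increase the sum, and there
  the bound is the convergent series of \<open>tail_series\<close>.\<close>

lemma trunc_mzv_bounded:
  assumes "admissible ks"
  shows "\<exists>B. \<forall>M. trunc_mzv 0 M ks \<le> B"
proof (cases ks rule: rev_cases)
  case (snoc js k)
  define B where "B = suminf (\<lambda>m. trunc_mzv 0 (Suc m) (replicate (length js) 1) / (real m + 1) ^ 2)"
  have sm: "summable (\<lambda>m. trunc_mzv 0 (Suc m) (replicate (length js) 1) / (real m + 1) ^ 2)"
    using tail_series[of "length js" 0] by (auto simp: sums_iff)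
  have le: "list_all2 (\<le>) (replicate (length js) 1 @ [2]) ks"
    using assms snoc by (auto simp: admissible_def list_all2_conv_all_nth nth_append)
  have "trunc_mzv 0 M ks \<le> B" for M
  proof -
    have "trunc_mzv 0 M ks \<le> trunc_mzv 0 (Suc M) ks"
      by (rule trunc_mzv_mono_bound) simp
    also have "\<dots> \<le> trunc_mzv 0 (Suc M) (replicate (length js) 1 @ [2])"
      by (rule trunc_mzv_mono[OF le])
    also have "\<dots> \<le> B"
      unfolding trunc_ones_two_eq B_def
      by (rule sum_le_suminf[OF sm]) (auto simp: trunc_mzv_nonneg)
    finally show ?thesis .
  qed
  then show ?thesis by blast
qed auto

text \<open>\<open>mzv\<close> is an unconditional sum, a limit along finite sets of tuples. The
  tuples below \<open>M\<close> form an increasing exhausting family of such sets, and boundedness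
  provides summability.\<close>

lemma trunc_mzv_tendsto_mzv:
  assumes "admissible ks"
  shows "(\<lambda>M. trunc_mzv 0 M ks) \<longlonglongrightarrow> mzv ks"
proof -
  define A where "A = {ms. length ms = length ks \<and> sorted_wrt (<) ms \<and> (\<forall>m\<in>set ms. (1::nat) \<le> m)}"
  let ?L = "\<lambda>M. increasing_lists 0 M (length ks)"
  have sub: "?L M \<subseteq> A" for M
    by (auto simp: increasing_lists_def A_def)
  have cover: "\<exists>M. F \<subseteq> ?L M" if "finite F" "F \<subseteq> A" for F
  proof -
    have "finite (\<Union>ms\<in>F. set ms)" using that by auto
    then obtain M where "\<forall>m\<in>(\<Union>ms\<in>F. set ms). m < M"
      using finite_nat_set_iff_bounded by blast
    then have "F \<subseteq> ?L M"
      using that by (fastforce simp: increasing_lists_def A_def)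
    then show ?thesis ..
  qed
  obtain B where B: "trunc_mzv 0 M ks \<le> B" for M
    using trunc_mzv_bounded[OF assms] by auto
  have "sum (mzv_term ks) F \<le> B" if "finite F" "F \<subseteq> A" for F
  proof -
    obtain M where "F \<subseteq> ?L M" using cover \<open>finite F\<close> \<open>F \<subseteq> A\<close> by blast
    then have "sum (mzv_term ks) F \<le> trunc_mzv 0 M ks"
      unfolding trunc_mzv_eq_sum
      by (intro sum_mono2 finite_increasing_lists mzv_term_nonneg)
    with B[of M] show ?thesis by simp
  qed
  then have "mzv_term ks summable_on A"
    by (intro nonneg_bounded_partial_sums_imp_summable_on[where C = B])
      (auto simp: mzv_term_nonneg eventually_finite_subsets_at_top)
  then have lim: "(sum (mzv_term ks) \<longlongrightarrow> infsum (mzv_term ks) A) (finite_subsets_at_top A)"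
    by (simp add: infsum_tendsto)
  have "filterlim ?L (finite_subsets_at_top A) sequentially"
    unfolding filterlim_finite_subsets_at_top eventually_sequentially
  proof (intro allI impI)
    fix X assume "finite X \<and> X \<subseteq> A"
    then obtain M where "X \<subseteq> ?L M" using cover by blast
    moreover have "?L M \<subseteq> ?L N" if "M \<le> N" for N
      using that by (auto simp: increasing_lists_def)
    ultimately show "\<exists>N. \<forall>n\<ge>N. finite (?L n) \<and> X \<subseteq> ?L n \<and> ?L n \<subseteq> A"
      using sub finite_increasing_lists by blast
  qed
  from filterlim_compose[OF lim this] show ?thesis
    by (simp add: trunc_mzv_eq_sum mzv_def A_def mzv_term_def[abs_def])
qed

lemma zeta_sums:
  assumes "2 \<le> k"
  shows "(\<lambda>n. 1 / (real n + 1) ^ k) sums mzv [k]"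
proof -
  have "trunc_mzv 0 (Suc M) [k] = (\<Sum>n<M. 1 / (real n + 1) ^ k)" for M
  proof (induction M)
    case 0
    have "{0<..<Suc 0} = {}" by auto
    then show ?case by (simp add: trunc_mzv.simps)
  next
    case (Suc M)
    then show ?case
      using trunc_mzv_snoc_Suc[of M "[]" k] by (simp add: add_ac)
  qed
  moreover have "(\<lambda>M. trunc_mzv 0 (Suc M) [k]) \<longlonglongrightarrow> mzv [k]"
    using assms by (intro LIMSEQ_Suc trunc_mzv_tendsto_mzv) (auto simp: admissible_def)
  ultimately show ?thesis
    by (simp add: sums_def)
qed

lemma tail_sum_tendsto:
  "(\<lambda>M. tail_sum M a j) \<longlonglongrightarrow> (-1) ^ j * real ((a + j + 1) choose j) * mzv [a + j + 2]"
proof -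
  have eq: "tail_sum (Suc M) a j =
      (\<Sum>m<M. (-1) ^ j * (trunc_mzv 0 (Suc m) (replicate a 1) * complete_hom (Suc m) j / (real m + 1) ^ 2))" for M
  proof (induction M)
    case 0
    have "{0<..<Suc 0} = {}" by auto
    then show ?case by (simp add: tail_sum_def)
  next
    case (Suc M)
    have "{0<..<Suc (Suc M)} = insert (Suc M) {0<..<Suc M}" by auto
    then have "tail_sum (Suc (Suc M)) a j = tail_sum (Suc M) a j +
        (-1) ^ j * (trunc_mzv 0 (Suc M) (replicate a 1) * complete_hom (Suc M) j / (real M + 1) ^ 2)"
      by (simp add: tail_sum_def add_ac)
    with Suc show ?case by simp
  qed
  have "suminf (\<lambda>k. 1 / (real k + 1) ^ (a + j + 2)) = mzv [a + j + 2]"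
    using zeta_sums[of "a + j + 2"] by (simp add: sums_iff)
  with sums_mult[OF tail_series[of a j], of "(-1) ^ j"]
  have "(\<lambda>M. tail_sum (Suc M) a j) \<longlonglongrightarrow> (-1) ^ j * (real ((a + j + 1) choose j) * mzv [a + j + 2])"
    unfolding eq by (simp only: sums_def)
  then show ?thesis
    by (subst (asm) filterlim_sequentially_Suc) (simp only: mult.assoc)
qed

text \<open>For \<open>j = 0\<close> no trailing ones are divided out, so \<open>tail_sum\<close> is
  the truncated value itself.\<close>

lemma mzv_ones_two: "mzv (replicate a 1 @ [2]) = mzv [a + 2]"
proof -
  have "(\<lambda>M. tail_sum M a 0) = (\<lambda>M. trunc_mzv 0 M (replicate a 1 @ [2]))"
    by (simp add: tail_sum_def trunc_mzv_append fun_eq_iff)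
  then have "(\<lambda>M. trunc_mzv 0 M (replicate a 1 @ [2])) \<longlonglongrightarrow> mzv [a + 2]"
    using tail_sum_tendsto[of a 0] by simp
  moreover have "(\<lambda>M. trunc_mzv 0 M (replicate a 1 @ [2])) \<longlonglongrightarrow> mzv (replicate a 1 @ [2])"
    by (rule trunc_mzv_tendsto_mzv) (auto simp: admissible_def)
  ultimately show ?thesis
    by (rule LIMSEQ_unique[symmetric])
qed

section \<open>Rational scalars\<close>

lemma lookup_scal_mult: "Poly_Mapping.lookup (scal q * x) w = q * Poly_Mapping.lookup x w"
  unfolding scal_def mult_map_scale_conv_mult[symmetric]
  by (simp add: Poly_Mapping.map.rep_eq when_def)

lemma keys_scal_mult: "Poly_Mapping.keys (scal q * x) \<subseteq> Poly_Mapping.keys x"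
  by (auto simp: in_keys_iff lookup_scal_mult)

lemma scal_0 [simp]: "scal 0 = 0" and scal_1 [simp]: "scal 1 = 1"
  by (simp_all add: scal_def)

lemma scal_add: "scal (p + q) = scal p + scal q"
  by (simp add: scal_def single_add)

lemma scal_mult: "scal (p * q) = scal p * scal q"
  by (simp add: scal_def mult_single)

lemma scal_mult_single: "scal q * Poly_Mapping.single w 1 = Poly_Mapping.single w q"
  by (simp add: scal_def mult_single)

section \<open>Linear extension from words\<close>

text \<open>One notion of linear extension serves two targets: \<open>scal\<close> gives maps into
  the Hoffman algebra, \<open>of_rat\<close> gives real-valued ones such as
  \<open>Zeval\<close>.\<close>

locale rat_hom =
  fixes h :: "rat \<Rightarrow> 'r :: ring_1"
  assumes h_add: "h (p + q) = h p + h q"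
    and h_mult: "h (p * q) = h p * h q"
    and h_1: "h 1 = 1"
begin

lemma h_0: "h 0 = 0"
  using h_add[of 0 0] by simp

definition lin :: "(hword \<Rightarrow> 'r) \<Rightarrow> hoffman \<Rightarrow> 'r" where
  "lin g x = (\<Sum>w\<in>Poly_Mapping.keys x. h (Poly_Mapping.lookup x w) * g w)"

lemma lin_superset:
  assumes "finite A" "Poly_Mapping.keys x \<subseteq> A"
  shows "lin g x = (\<Sum>w\<in>A. h (Poly_Mapping.lookup x w) * g w)"
  unfolding lin_def using assms
  by (intro sum.mono_neutral_left) (auto simp: in_keys_iff h_0)

lemma lin_add: "lin g (x + y) = lin g x + lin g y"
proof -
  let ?A = "Poly_Mapping.keys x \<union> Poly_Mapping.keys y"
  have "Poly_Mapping.keys (x + y) \<subseteq> ?A" by (rule keys_add)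
  then show ?thesis
    by (simp add: lin_superset[of ?A] lookup_add h_add distrib_right sum.distrib)
qed

lemma lin_0 [simp]: "lin g 0 = 0"
  by (simp add: lin_def)

lemma lin_single: "lin g (Poly_Mapping.single w c) = h c * g w"
  by (subst lin_superset[of "{w}"]) auto

lemma lin_sum: "lin g (sum X I) = (\<Sum>i\<in>I. lin g (X i))"
  by (induction I rule: infinite_finite_induct) (auto simp: lin_add)

lemma lin_diff: "lin g (x - y) = lin g x - lin g y"
  using lin_add[of g "x - y" y] by simp

lemma lin_sum_list: "lin g (sum_list xs) = sum_list (map (lin g) xs)"
  by (induction xs) (auto simp: lin_add)

lemma lin_scal_mult: "lin g (scal q * x) = h q * lin g x"
  by (subst lin_superset[OF finite_keys keys_scal_mult])
    (simp add: lin_def lookup_scal_mult h_mult sum_distrib_left mult.assoc)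

lemma lin_cong: "(\<And>w. w \<in> Poly_Mapping.keys x \<Longrightarrow> g w = g' w) \<Longrightarrow> lin g x = lin g' x"
  by (simp add: lin_def)

lemma lin_fun_add: "lin (\<lambda>w. g w + g' w) x = lin g x + lin g' x"
  by (simp add: lin_def distrib_left sum.distrib)

lemma lin_mult_right: "lin (\<lambda>w. g w * c) x = lin g x * c"
  by (simp add: lin_def sum_distrib_right mult.assoc)

end

interpretation scal: rat_hom scal
  by standard (simp_all add: scal_add scal_mult)

interpretation real: rat_hom "of_rat :: rat \<Rightarrow> real"
  by standard (simp_all add: of_rat_add of_rat_mult)

lemma (in rat_hom) lin_lin: "lin g (scal.lin f x) = lin (\<lambda>w. lin g (f w)) x"
  by (simp add: scal.lin_def lin_sum lin_scal_mult lin_def[of "\<lambda>w. lin g (f w)"])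

lemma scal_lin_single: "scal.lin (\<lambda>w. Poly_Mapping.single w 1) x = x"
proof -
  have "Poly_Mapping.lookup (scal.lin (\<lambda>w. Poly_Mapping.single w 1) x) v = Poly_Mapping.lookup x v" for v
  proof -
    have "Poly_Mapping.lookup (scal.lin (\<lambda>w. Poly_Mapping.single w 1) x) v =
        (\<Sum>w\<in>Poly_Mapping.keys x. if w = v then Poly_Mapping.lookup x w else 0)"
      by (simp add: scal.lin_def scal_mult_single lookup_sum lookup_single when_def)
    also have "\<dots> = Poly_Mapping.lookup x v"
      by (simp add: in_keys_iff)
    finally show ?thesis .
  qed
  then show ?thesis by (rule poly_mapping_eqI)
qed

lemma bilinear_ext_eq_lin: "bilinear_ext f x y = scal.lin (\<lambda>u. scal.lin (f u) y) x"
  by (simp add: bilinear_ext_def scal.lin_def scal_mult sum_distrib_left mult.assoc)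

lemma Zeval_eq_lin: "Zeval = real.lin (\<lambda>w. mzv (index_of (letters w)))"
  by (simp add: fun_eq_iff Zeval_def real.lin_def)

section \<open>Membership in \<open>H1\<close> and \<open>H0\<close>\<close>

lemma keys_e1_mult: "w \<in> Poly_Mapping.keys (e1 * x) \<Longrightarrow> \<exists>v\<in>Poly_Mapping.keys x. letters w = E1 # letters v"
  using subsetD[OF keys_mult[of e1 x], of w] by (auto simp: lett_def plus_hword_def)

lemma keys_mult_e0: "w \<in> Poly_Mapping.keys (x * e0) \<Longrightarrow> \<exists>v\<in>Poly_Mapping.keys x. letters w = letters v @ [E0]"
  using subsetD[OF keys_mult[of x e0], of w] by (auto simp: lett_def plus_hword_def)

lemma keys_scal: "w \<in> Poly_Mapping.keys (scal q) \<Longrightarrow> letters w = []"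
  by (auto simp: scal_def zero_hword_def split: if_splits)

lemma H1_add: "x \<in> H1 \<Longrightarrow> y \<in> H1 \<Longrightarrow> x + y \<in> H1"
  unfolding H1_def
proof clarify
  fix p q u v
  have "scal p + e1 * u + (scal q + e1 * v) = scal (p + q) + e1 * (u + v)"
    by (simp add: scal_add distrib_left)
  then show "\<exists>q' x'. scal p + e1 * u + (scal q + e1 * v) = scal q' + e1 * x' \<and> True"
    by blast
qed

lemma H0_add: "x \<in> H0 \<Longrightarrow> y \<in> H0 \<Longrightarrow> x + y \<in> H0"
  unfolding H0_def
proof clarify
  fix p q u v
  have "scal p + e1 * u * e0 + (scal q + e1 * v * e0) = scal (p + q) + e1 * (u + v) * e0"
    by (simp add: scal_add distrib_left distrib_right)
  then show "\<exists>q' x'. scal p + e1 * u * e0 + (scal q + e1 * v * e0) = scal q' + e1 * x' * e0 \<and> True"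
    by blast
qed

lemma scal_in_H1: "scal q \<in> H1" and scal_in_H0: "scal q \<in> H0"
proof -
  have "scal q = scal q + e1 * 0" "scal q = scal q + e1 * 0 * e0" by simp_all
  then show "scal q \<in> H1" "scal q \<in> H0" unfolding H1_def H0_def by blast+
qed

lemma H1_sum: "(\<And>i. i \<in> I \<Longrightarrow> X i \<in> H1) \<Longrightarrow> sum X I \<in> H1"
  using scal_in_H1[of 0] by (induction I rule: infinite_finite_induct) (auto simp: H1_add)

lemma H0_sum: "(\<And>i. i \<in> I \<Longrightarrow> X i \<in> H0) \<Longrightarrow> sum X I \<in> H0"
  using scal_in_H0[of 0] by (induction I rule: infinite_finite_induct) (auto simp: H0_add)

text \<open>Turns membership into a condition on the support, which can be checked word by
  word.\<close>

lemma H1_iff: "x \<in> H1 \<longleftrightarrow> (\<forall>w\<in>Poly_Mapping.keys x. letters w = [] \<or> hd (letters w) = E1)"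
proof
  assume "x \<in> H1"
  then obtain q y where "x = scal q + e1 * y" unfolding H1_def by blast
  then show "\<forall>w\<in>Poly_Mapping.keys x. letters w = [] \<or> hd (letters w) = E1"
    using keys_add[of "scal q" "e1 * y"] keys_scal keys_e1_mult by fastforce
next
  assume *: "\<forall>w\<in>Poly_Mapping.keys x. letters w = [] \<or> hd (letters w) = E1"
  have "scal (Poly_Mapping.lookup x w) * Poly_Mapping.single w 1 \<in> H1" if w: "w \<in> Poly_Mapping.keys x" for w
  proof (cases "letters w")
    case Nil
    then have "w = 0" by (cases w) (simp add: zero_hword_def)
    then show ?thesis by (simp add: scal_in_H1)
  next
    case (Cons a u)
    with * w have "w = Word (E1 # u)" by (cases w) force
    then have "scal (Poly_Mapping.lookup x w) * Poly_Mapping.single w 1 =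
        scal 0 + e1 * Poly_Mapping.single (Word u) (Poly_Mapping.lookup x w)"
      by (simp add: scal_mult_single lett_def mult_single plus_hword_def)
    then show ?thesis unfolding H1_def by blast
  qed
  then have "scal.lin (\<lambda>w. Poly_Mapping.single w 1) x \<in> H1"
    unfolding scal.lin_def by (rule H1_sum)
  then show "x \<in> H1" by (simp add: scal_lin_single)
qed

lemma H0_iff:
  "x \<in> H0 \<longleftrightarrow> (\<forall>w\<in>Poly_Mapping.keys x. letters w = [] \<or> hd (letters w) = E1 \<and> last (letters w) = E0)"
proof
  assume "x \<in> H0"
  then obtain q y where x: "x = scal q + e1 * y * e0" unfolding H0_def by blast
  show "\<forall>w\<in>Poly_Mapping.keys x. letters w = [] \<or> hd (letters w) = E1 \<and> last (letters w) = E0"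
  proof
    fix w assume "w \<in> Poly_Mapping.keys x"
    then consider "w \<in> Poly_Mapping.keys (scal q)" | "w \<in> Poly_Mapping.keys (e1 * y * e0)"
      using keys_add[of "scal q" "e1 * y * e0"] x by blast
    then show "letters w = [] \<or> hd (letters w) = E1 \<and> last (letters w) = E0"
    proof cases
      case 2
      then obtain v where v: "v \<in> Poly_Mapping.keys (e1 * y)" "letters w = letters v @ [E0]"
        using keys_mult_e0 by blast
      with keys_e1_mult[OF v(1)] show ?thesis by auto
    qed (simp add: keys_scal)
  qed
next
  assume *: "\<forall>w\<in>Poly_Mapping.keys x. letters w = [] \<or> hd (letters w) = E1 \<and> last (letters w) = E0"
  have "scal (Poly_Mapping.lookup x w) * Poly_Mapping.single w 1 \<in> H0" if w: "w \<in> Poly_Mapping.keys x" for w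
  proof (cases "letters w = []")
    case True
    then have "w = 0" by (cases w) (simp add: zero_hword_def)
    then show ?thesis by (simp add: scal_in_H0)
  next
    case False
    with * w have hl: "hd (letters w) = E1" "last (letters w) = E0" by auto
    obtain b u where u: "letters w = b # u" using False by (cases "letters w") auto
    \<comment> \<open>A single letter cannot be both the initial \<open>E1\<close> and the final
      \<open>E0\<close>, so the word has at least two letters.\<close>
    with hl have "u \<noteq> []" by (cases u) auto
    then obtain v c where "u = v @ [c]" by (cases u rule: rev_cases) auto
    with u hl have "w = Word (E1 # v @ [E0])" by (cases w) auto
    then have "scal (Poly_Mapping.lookup x w) * Poly_Mapping.single w 1 =
        scal 0 + e1 * Poly_Mapping.single (Word v) (Poly_Mapping.lookup x w) * e0"
      by (simp add: scal_mult_single lett_def mult_single plus_hword_def)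
    then show ?thesis unfolding H0_def by blast
  qed
  then have "scal.lin (\<lambda>w. Poly_Mapping.single w 1) x \<in> H0"
    unfolding scal.lin_def by (rule H0_sum)
  then show "x \<in> H0" by (simp add: scal_lin_single)
qed

lemma H1_scal_mult: "x \<in> H1 \<Longrightarrow> scal q * x \<in> H1"
  using keys_scal_mult[of q x] by (auto simp: H1_iff)

lemma H1_diff: "x \<in> H1 \<Longrightarrow> y \<in> H1 \<Longrightarrow> x - y \<in> H1"
  using keys_diff[of x y] by (fastforce simp: H1_iff)

lemma H1_sum_list: "(\<And>x. x \<in> set xs \<Longrightarrow> x \<in> H1) \<Longrightarrow> sum_list xs \<in> H1"
  using scal_in_H1[of 0] by (induction xs) (auto simp: H1_add)

lemma scal_lin_in_H1: "(\<And>w. w \<in> Poly_Mapping.keys x \<Longrightarrow> g w \<in> H1) \<Longrightarrow> scal.lin g x \<in> H1"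
  unfolding scal.lin_def by (intro H1_sum H1_scal_mult)

lemma zmon_in_H1: "zmon ks \<in> H1"
  by (cases ks) (auto simp: zmon_eq_single H1_iff index_word_def)

section \<open>Indices and words\<close>

definition pos_index :: "nat list \<Rightarrow> bool" where
  "pos_index ks \<longleftrightarrow> (\<forall>k\<in>set ks. 1 \<le> k)"

lemma pos_index_simps [simp]:
  "pos_index []"
  "pos_index (k # ks) \<longleftrightarrow> 1 \<le> k \<and> pos_index ks"
  "pos_index (ks @ ls) \<longleftrightarrow> pos_index ks \<and> pos_index ls"
  "pos_index (replicate n (Suc 0))"
  by (auto simp: pos_index_def)

lemma pos_index_index_of: "pos_index (index_of w)"
  by (induction w rule: index_of.induct) auto

lemma pos_index_butlast: "pos_index ks \<Longrightarrow> pos_index (butlast ks)"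
  by (auto simp: pos_index_def dest: in_set_butlastD)

lemma index_of_word: "pos_index ks \<Longrightarrow> index_of (index_word ks) = ks"
  using index_of_index_word by (simp add: pos_index_def)

lemma index_word_Cons: "index_word (k # ks) = E1 # replicate (k - 1) E0 @ index_word ks"
  by (simp add: index_word_def)

lemma index_word_append: "index_word (ks @ ls) = index_word ks @ index_word ls"
  by (simp add: index_word_def)

lemma index_word_index_of: "u = [] \<or> hd u = E1 \<Longrightarrow> index_word (index_of u) = u"
proof (induction u rule: index_of.induct)
  case (3 w)
  have hd: "dropWhile (\<lambda>a. a = E0) w = [] \<or> hd (dropWhile (\<lambda>a. a = E0) w) = E1"
    using hd_dropWhile[of "\<lambda>a. a = E0" w] by (cases "hd (dropWhile (\<lambda>a. a = E0) w)") auto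
  have "replicate (length (takeWhile (\<lambda>a. a = E0) w)) E0 = takeWhile (\<lambda>a. a = E0) w"
    by (rule replicate_length_same[of _ E0]) (auto dest: set_takeWhileD)
  then show ?case
    using 3(1)[OF hd] by (simp add: index_word_Cons)
qed (auto simp: index_word_def)

definition ends_in_one :: "nat list \<Rightarrow> bool" where
  "ends_in_one ks \<longleftrightarrow> ks \<noteq> [] \<and> last ks = 1"

lemma index_word_snoc_eq: "index_word (ks @ [k]) = index_word ks @ E1 # replicate (k - 1) E0"
  by (simp add: index_word_append index_word_def)

text \<open>A final entry 1 is a block without \<open>E0\<close>; a block of any larger entry ends
  in \<open>E0\<close>.\<close>

lemma last_index_word:
  assumes "pos_index ks" "ks \<noteq> []"
  shows "last (index_word ks) = (if ends_in_one ks then E1 else E0)"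
proof (cases ks rule: rev_cases)
  case (snoc js k)
  with assms have "1 \<le> k" by simp
  with snoc show ?thesis
    by (cases "k = 1") (auto simp: index_word_snoc_eq ends_in_one_def last_append)
qed (use assms in simp)

lemma index_word_eq_Nil_iff [simp]: "index_word ks = [] \<longleftrightarrow> ks = []"
  by (cases ks) (simp_all add: index_word_def)

lemma butlast_index_word: "ends_in_one ks \<Longrightarrow> butlast (index_word ks) = index_word (butlast ks)"
  by (cases ks rule: rev_cases) (auto simp: ends_in_one_def index_word_snoc_eq butlast_append)

section \<open>The stuffle product on indices\<close>

text \<open>The recursion of \<open>stuffle_indices\<close>, but listing the resulting indices with
  multiplicity, so that any functional can be summed over them.\<close>

fun stuffle_lists :: "nat list \<Rightarrow> nat list \<Rightarrow> nat list list" where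
  "stuffle_lists [] ls = [ls]"
| "stuffle_lists ks [] = [ks]"
| "stuffle_lists (k # ks) (l # ls) =
     map (Cons k) (stuffle_lists ks (l # ls)) @ map (Cons l) (stuffle_lists (k # ks) ls)
     @ map (Cons (k + l)) (stuffle_lists ks ls)"

lemma stuffle_lists_Nil_right [simp]: "stuffle_lists ks [] = [ks]"
  by (cases ks) auto

lemma zmon_Cons: "zmon (k # ks) = zgen k * zmon ks"
  by (simp add: zmon_def)

lemma stuffle_indices_eq: "stuffle_indices ks ls = sum_list (map zmon (stuffle_lists ks ls))"
proof (induction ks ls rule: stuffle_indices.induct)
  case (3 k ks l ls)
  have "sum_list (map zmon (map (Cons j) xss)) = zgen j * sum_list (map zmon xss)" for j xss
    by (induction xss) (simp_all add: zmon_Cons distrib_left)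
  then show ?case
    unfolding stuffle_indices.simps stuffle_lists.simps map_append sum_list_append 3
    by (simp only: add.assoc)
qed auto

lemma pos_index_stuffle:
    "pos_index ks \<Longrightarrow> pos_index ls \<Longrightarrow> ms \<in> set (stuffle_lists ks ls) \<Longrightarrow> pos_index ms"
proof (induction ks ls arbitrary: ms rule: stuffle_lists.induct)
  case (3 k ks l ls)
  from 3(6) obtain j ms' where ms: "ms = j # ms'"
    and j: "j = k \<and> ms' \<in> set (stuffle_lists ks (l # ls)) \<or> j = l \<and> ms' \<in> set (stuffle_lists (k # ks) ls)
      \<or> j = k + l \<and> ms' \<in> set (stuffle_lists ks ls)"
    by auto
  have "1 \<le> k" "1 \<le> l" and pos: "pos_index ks" "pos_index ls"
    using 3(4,5) by simp_all
  then have "1 \<le> j"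
    using j by linarith
  moreover have "pos_index ms'"
    using j 3(1)[OF pos(1) 3(5)] 3(2)[OF 3(4) pos(2)] 3(3)[OF pos] by blast
  ultimately show ?case by (simp add: ms)
qed simp_all

lemma stuffle_lists_nonempty:
  "ks \<noteq> [] \<or> ls \<noteq> [] \<Longrightarrow> ms \<in> set (stuffle_lists ks ls) \<Longrightarrow> ms \<noteq> []"
  by (cases ks; cases ls) auto

text \<open>The pairs of variables are sorted by which one is smaller or whether they coincide: the
  three terms of the stuffle recursion.\<close>

lemma sum_mult_sum_split:
  fixes f g :: "nat \<Rightarrow> real"
  shows "sum f {p<..<M} * sum g {p<..<M} =
    (\<Sum>m\<in>{p<..<M}. f m * sum g {m<..<M}) + (\<Sum>m\<in>{p<..<M}. g m * sum f {m<..<M})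
    + (\<Sum>m\<in>{p<..<M}. f m * g m)"
proof (induction "M - p" arbitrary: p)
  case 0
  then have "{p<..<M} = {}" by auto
  then show ?case by simp
next
  case (Suc n)
  show ?case
  proof (cases "Suc p < M")
    case True
    then have "{p<..<M} = insert (Suc p) {Suc p<..<M}" by auto
    then have ins: "sum u {p<..<M} = u (Suc p) + sum u {Suc p<..<M}" for u :: "nat \<Rightarrow> real"
      by simp
    have IH: "sum f {Suc p<..<M} * sum g {Suc p<..<M} =
        (\<Sum>m\<in>{Suc p<..<M}. f m * sum g {m<..<M}) + (\<Sum>m\<in>{Suc p<..<M}. g m * sum f {m<..<M})
        + (\<Sum>m\<in>{Suc p<..<M}. f m * g m)"
      using Suc.hyps(2) by (intro Suc.hyps(1)) simp
    show ?thesis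
      unfolding ins distrib_left distrib_right IH by (simp only: mult.commute add_ac)
  next
    case False
    then have "{p<..<M} = {}" by auto
    then show ?thesis by simp
  qed
qed

lemma trunc_mzv_stuffle:
  "sum_list (map (trunc_mzv p M) (stuffle_lists ks ls)) = trunc_mzv p M ks * trunc_mzv p M ls"
proof (induction ks ls arbitrary: p rule: stuffle_lists.induct)
  case (3 k ks l ls)
  have Cons: "sum_list (map (trunc_mzv p M) (map (Cons j) xss)) =
      (\<Sum>m\<in>{p<..<M}. sum_list (map (trunc_mzv m M) xss) / real m ^ j)" for j xss
    by (induction xss) (simp_all add: trunc_mzv.simps sum.distrib add_divide_distrib)
  have "sum_list (map (trunc_mzv p M) (stuffle_lists (k # ks) (l # ls))) =
      (\<Sum>m\<in>{p<..<M}. trunc_mzv m M ks / real m ^ k * trunc_mzv m M (l # ls))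
      + (\<Sum>m\<in>{p<..<M}. trunc_mzv m M ls / real m ^ l * trunc_mzv m M (k # ks))
      + (\<Sum>m\<in>{p<..<M}. trunc_mzv m M ks / real m ^ k * (trunc_mzv m M ls / real m ^ l))"
    unfolding stuffle_lists.simps map_append sum_list_append Cons 3
    by (simp add: mult_ac power_add)
  also have "\<dots> = trunc_mzv p M (k # ks) * trunc_mzv p M (l # ls)"
    unfolding trunc_mzv.simps(2) by (rule sum_mult_sum_split[symmetric])
  finally show ?case .
qed auto

section \<open>Removing a final entry 1 from indices\<close>

definition strip_ones :: "nat list list \<Rightarrow> nat list list" where
  "strip_ones xss = map butlast (filter ends_in_one xss)"

lemma strip_ones_append: "strip_ones (xss @ yss) = strip_ones xss @ strip_ones yss"
  by (simp add: strip_ones_def)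

text \<open>A nonempty tail keeps its last entry under a prefix; an empty one would make the new
  entry the last.\<close>

lemma strip_ones_Cons_map:
  "(\<And>ms. ms \<in> set xss \<Longrightarrow> ms \<noteq> []) \<Longrightarrow> strip_ones (map (Cons k) xss) = map (Cons k) (strip_ones xss)"
  by (induction xss) (auto simp: strip_ones_def ends_in_one_def)

text \<open>Removing a final entry 1 is a derivation for the stuffle product.\<close>

lemma strip_ones_stuffle:
  assumes "pos_index ks" "pos_index ls"
  shows "mset (strip_ones (stuffle_lists ks ls)) =
    mset ((if ends_in_one ks then stuffle_lists (butlast ks) ls else [])
      @ (if ends_in_one ls then stuffle_lists ks (butlast ls) else []))"
  using assms
proof (induction ks ls rule: stuffle_lists.induct)
  case (3 k ks l ls)
  note ne = stuffle_lists_nonempty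
  have s: "strip_ones (map (Cons k) (stuffle_lists ks (l # ls))) = map (Cons k) (strip_ones (stuffle_lists ks (l # ls)))"
    "strip_ones (map (Cons l) (stuffle_lists (k # ks) ls)) = map (Cons l) (strip_ones (stuffle_lists (k # ks) ls))"
    by (rule strip_ones_Cons_map; use ne in blast)+
  \<comment> \<open>With both tails empty the merged entry is the last one. It is at least 2 by
    positivity, so nothing is stripped on either side.\<close>
  have t: "strip_ones (map (Cons (k + l)) (stuffle_lists ks ls)) = map (Cons (k + l)) (strip_ones (stuffle_lists ks ls))"
  proof (cases "ks = [] \<and> ls = []")
    case True
    with 3 show ?thesis by (auto simp: strip_ones_def ends_in_one_def)
  next
    case False
    then show ?thesis by (intro strip_ones_Cons_map) (use ne in blast)
  qed
  have e: "ends_in_one (j # js) \<longleftrightarrow> (if js = [] then j = 1 else ends_in_one js)" for j js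
    by (simp add: ends_in_one_def)
  have IH: "mset (strip_ones (stuffle_lists ks (l # ls))) = mset ((if ends_in_one ks then stuffle_lists (butlast ks) (l # ls) else [])
      @ (if ends_in_one (l # ls) then stuffle_lists ks (butlast (l # ls)) else []))"
    "mset (strip_ones (stuffle_lists (k # ks) ls)) = mset ((if ends_in_one (k # ks) then stuffle_lists (butlast (k # ks)) ls else [])
      @ (if ends_in_one ls then stuffle_lists (k # ks) (butlast ls) else []))"
    "mset (strip_ones (stuffle_lists ks ls)) = mset ((if ends_in_one ks then stuffle_lists (butlast ks) ls else [])
      @ (if ends_in_one ls then stuffle_lists ks (butlast ls) else []))"
    using 3 by auto
  have nil: "\<not> ends_in_one []" by (simp add: ends_in_one_def)
  show ?case
    unfolding stuffle_lists.simps strip_ones_append s t mset_append mset_map IH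
    by (cases "ks = []"; cases "ls = []") (simp_all add: e nil)
qed (auto simp: strip_ones_def ends_in_one_def)

section \<open>Truncated evaluation and the derivation on the Hoffman algebra\<close>

definition trunc_eval :: "nat \<Rightarrow> hoffman \<Rightarrow> real" where
  "trunc_eval M = real.lin (\<lambda>w. trunc_mzv 0 M (index_of (letters w)))"

lemma trunc_eval_zmon: "pos_index ks \<Longrightarrow> trunc_eval M (zmon ks) = trunc_mzv 0 M ks"
  by (simp add: trunc_eval_def zmon_eq_single real.lin_single index_of_word)

lemma trunc_eval_stuffle_indices:
  assumes "pos_index ks" "pos_index ls"
  shows "trunc_eval M (stuffle_indices ks ls) = trunc_mzv 0 M ks * trunc_mzv 0 M ls"
proof -
  have "trunc_eval M (stuffle_indices ks ls) = sum_list (map (\<lambda>ms. trunc_eval M (zmon ms)) (stuffle_lists ks ls))"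
    unfolding stuffle_indices_eq by (simp add: trunc_eval_def real.lin_sum_list comp_def)
  also have "\<dots> = sum_list (map (trunc_mzv 0 M) (stuffle_lists ks ls))"
    using pos_index_stuffle[OF assms] trunc_eval_zmon
    by (intro arg_cong[of _ _ sum_list] map_cong refl) blast
  finally show ?thesis by (simp add: trunc_mzv_stuffle)
qed

lemma real_lin_mult_left: "real.lin (\<lambda>w. c * g w) x = c * real.lin g x"
  by (simp add: real.lin_def sum_distrib_left mult_ac)

text \<open>Both sides see words only through \<open>index_of\<close>, so bilinearity reduces the
  claim to \<open>trunc_mzv_stuffle\<close>.\<close>

lemma trunc_eval_stuffle_prod: "trunc_eval M (stuffle_prod x y) = trunc_eval M x * trunc_eval M y"
proof -
  have eval: "trunc_eval M (stuffle_indices (index_of u) (index_of v)) =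
      trunc_mzv 0 M (index_of u) * trunc_mzv 0 M (index_of v)" for u v
    by (intro trunc_eval_stuffle_indices pos_index_index_of)
  have "trunc_eval M (stuffle_prod x y) =
      real.lin (\<lambda>u. real.lin (\<lambda>v. trunc_eval M (stuffle_indices (index_of (letters u)) (index_of (letters v)))) y) x"
    unfolding stuffle_prod_def bilinear_ext_eq_lin trunc_eval_def real.lin_lin ..
  also have "\<dots> = trunc_eval M x * trunc_eval M y"
    unfolding eval by (simp only: real_lin_mult_left real.lin_mult_right trunc_eval_def)
  finally show ?thesis .
qed

definition strip_one :: "hoffman \<Rightarrow> hoffman" where
  "strip_one = scal.lin (\<lambda>w. if letters w \<noteq> [] \<and> last (letters w) = E1
     then Poly_Mapping.single (Word (butlast (letters w))) 1 else 0)"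

lemma strip_one_zmon:
  "pos_index ks \<Longrightarrow> strip_one (zmon ks) = (if ends_in_one ks then zmon (butlast ks) else 0)"
  by (auto simp: strip_one_def zmon_eq_single scal.lin_single last_index_word butlast_index_word
      ends_in_one_def)

text \<open>The order of a list is lost under summation, so the multiset identity
  \<open>strip_ones_stuffle\<close> is enough.\<close>

lemma strip_one_stuffle_indices:
  assumes "pos_index ks" "pos_index ls"
  shows "strip_one (stuffle_indices ks ls) =
    (if ends_in_one ks then stuffle_indices (butlast ks) ls else 0)
    + (if ends_in_one ls then stuffle_indices ks (butlast ls) else 0)"
proof -
  have list: "strip_one (sum_list (map zmon xss)) = sum_list (map zmon (strip_ones xss))"
    if "\<And>ms. ms \<in> set xss \<Longrightarrow> pos_index ms" for xss
    using that
  proof (induction xss)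
    case (Cons ms xss)
    then have "strip_one (zmon ms + sum_list (map zmon xss)) =
        (if ends_in_one ms then zmon (butlast ms) else 0) + sum_list (map zmon (strip_ones xss))"
      using strip_one_zmon[of ms] by (simp add: strip_one_def scal.lin_add)
    then show ?case by (simp add: strip_ones_def)
  qed (simp add: strip_one_def strip_ones_def)
  have sum: "sum_list (map zmon xss) = \<Sum>\<^sub># (image_mset zmon (mset xss))" for xss
    by (metis mset_map sum_mset_sum_list)
  have "strip_one (stuffle_indices ks ls) = \<Sum>\<^sub># (image_mset zmon (mset (strip_ones (stuffle_lists ks ls))))"
    using list[of "stuffle_lists ks ls"] pos_index_stuffle[OF assms]
    unfolding stuffle_indices_eq sum by blast
  also have "\<dots> = (if ends_in_one ks then stuffle_indices (butlast ks) ls else 0)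
    + (if ends_in_one ls then stuffle_indices ks (butlast ls) else 0)"
    unfolding strip_ones_stuffle[OF assms] stuffle_indices_eq sum by simp
  finally show ?thesis .
qed

lemma stuffle_prod_zmon_left:
  "pos_index ks \<Longrightarrow> stuffle_prod (zmon ks) x = scal.lin (\<lambda>v. stuffle_indices ks (index_of (letters v))) x"
  by (simp add: stuffle_prod_def bilinear_ext_eq_lin zmon_eq_single scal.lin_single index_of_word)

lemma stuffle_prod_zmon_in_H1: "pos_index ks \<Longrightarrow> stuffle_prod (zmon ks) x \<in> H1"
  unfolding stuffle_prod_zmon_left stuffle_indices_eq
  by (intro scal_lin_in_H1 H1_sum_list) (auto simp: zmon_in_H1)

lemma stuffle_prod_0_right: "pos_index ks \<Longrightarrow> stuffle_prod (zmon ks) 0 = 0"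
  by (simp add: stuffle_prod_zmon_left)

lemma stuffle_prod_Nil_left: "x \<in> H1 \<Longrightarrow> stuffle_prod (zmon []) x = x"
proof -
  assume "x \<in> H1"
  then have "stuffle_prod (zmon []) x = scal.lin (\<lambda>w. Poly_Mapping.single w 1) x"
    unfolding stuffle_prod_zmon_left[OF pos_index_simps(1)]
    by (intro scal.lin_cong) (auto simp: zmon_eq_single H1_iff index_word_index_of)
  then show ?thesis by (simp add: scal_lin_single)
qed

text \<open>The Leibniz rule used for \<open>tail_word\<close>. Membership in \<open>H1\<close>
  ensures that the words of \<open>x\<close> are recovered from their indices.\<close>

lemma strip_one_stuffle_prod:
  assumes ks: "pos_index ks" and x: "x \<in> H1"
  shows "strip_one (stuffle_prod (zmon ks) x) =
    (if ends_in_one ks then stuffle_prod (zmon (butlast ks)) x else 0) + stuffle_prod (zmon ks) (strip_one x)"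
proof -
  let ?ix = "\<lambda>v. index_of (letters v)"
  have word: "(if letters v \<noteq> [] \<and> last (letters v) = E1 then Poly_Mapping.single (Word (butlast (letters v))) 1 else 0)
      = (if ends_in_one (?ix v) then zmon (butlast (?ix v)) else 0)"
    if "v \<in> Poly_Mapping.keys x" for v
  proof -
    have "index_word (?ix v) = letters v"
      using x that by (intro index_word_index_of) (auto simp: H1_iff)
    then have "Poly_Mapping.single v 1 = zmon (?ix v)"
      by (simp add: zmon_eq_single)
    moreover have "strip_one (Poly_Mapping.single v 1) =
        (if letters v \<noteq> [] \<and> last (letters v) = E1 then Poly_Mapping.single (Word (butlast (letters v))) 1 else 0)"
      by (simp add: strip_one_def scal.lin_single)
    ultimately show ?thesis
      using strip_one_zmon[OF pos_index_index_of] by metis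
  qed
  have "stuffle_prod (zmon ks) (strip_one x) =
      scal.lin (\<lambda>v. scal.lin (\<lambda>v. stuffle_indices ks (?ix v))
        (if ends_in_one (?ix v) then zmon (butlast (?ix v)) else 0)) x"
    unfolding stuffle_prod_zmon_left[OF ks] strip_one_def scal.lin_lin
    by (rule scal.lin_cong) (simp only: word)
  also have "\<dots> = scal.lin (\<lambda>v. if ends_in_one (?ix v) then stuffle_indices ks (butlast (?ix v)) else 0) x"
    by (intro scal.lin_cong)
       (auto simp: zmon_eq_single scal.lin_single index_of_word pos_index_butlast pos_index_index_of)
  finally have right: "stuffle_prod (zmon ks) (strip_one x) = \<dots>" .
  have left: "(if ends_in_one ks then stuffle_prod (zmon (butlast ks)) x else 0) =
      scal.lin (\<lambda>v. if ends_in_one ks then stuffle_indices (butlast ks) (?ix v) else 0) x"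
    using stuffle_prod_zmon_left[OF pos_index_butlast[OF ks]] by (simp add: scal.lin_def)
  have "strip_one (stuffle_prod (zmon ks) x) = scal.lin (\<lambda>v. strip_one (stuffle_indices ks (?ix v))) x"
    unfolding stuffle_prod_zmon_left[OF ks] strip_one_def scal.lin_lin ..
  also have "\<dots> = scal.lin (\<lambda>v. (if ends_in_one ks then stuffle_indices (butlast ks) (?ix v) else 0)
      + (if ends_in_one (?ix v) then stuffle_indices ks (butlast (?ix v)) else 0)) x"
    by (intro scal.lin_cong strip_one_stuffle_indices ks pos_index_index_of)
  finally show ?thesis
    unfolding scal.lin_fun_add left right .
qed

text \<open>Words ending in \<open>E1\<close> keep distinct images, so nothing can cancel: a
  vanishing image means that no word of \<open>x\<close> ends in \<open>E1\<close>.\<close>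

lemma strip_one_eq_0_imp_H0:
  assumes x: "x \<in> H1" and s: "strip_one x = 0"
  shows "x \<in> H0"
  unfolding H0_iff
proof
  fix w assume w: "w \<in> Poly_Mapping.keys x"
  show "letters w = [] \<or> hd (letters w) = E1 \<and> last (letters w) = E0"
  proof (rule ccontr)
    assume "\<not> ?thesis"
    then have ne: "letters w \<noteq> []" and "last (letters w) \<noteq> E0"
      using x w by (auto simp: H1_iff)
    then have last: "last (letters w) = E1" by (cases "last (letters w)") auto
    have "Poly_Mapping.lookup (strip_one x) (Word (butlast (letters w))) =
        (\<Sum>v\<in>Poly_Mapping.keys x. if v = w then Poly_Mapping.lookup x v else 0)"
      unfolding strip_one_def scal.lin_def lookup_sum
    proof (rule sum.cong[OF refl])
      fix v
      have "butlast (letters v) = butlast (letters w) \<longleftrightarrow> v = w" if "letters v \<noteq> []" "last (letters v) = E1"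
        using that ne last by (metis append_butlast_last_id hword.expand)
      then show "Poly_Mapping.lookup (scal (Poly_Mapping.lookup x v) *
            (if letters v \<noteq> [] \<and> last (letters v) = E1 then Poly_Mapping.single (Word (butlast (letters v))) 1 else 0))
            (Word (butlast (letters w))) = (if v = w then Poly_Mapping.lookup x v else 0)"
        using ne last by (auto simp: scal_mult_single lookup_single when_def)
    qed
    also have "\<dots> = Poly_Mapping.lookup x w"
      using w by simp
    finally show False using s w by (simp add: in_keys_iff)
  qed
qed

text \<open>Words in the support of an element of \<open>H0\<close> have admissible indices, so this
  is a finite linear combination of convergent truncations.\<close>

lemma trunc_eval_tendsto_Zeval:
  assumes "x \<in> H0"
  shows "(\<lambda>M. trunc_eval M x) \<longlonglongrightarrow> Zeval x"
  unfolding trunc_eval_def Zeval_eq_lin real.lin_def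
proof (intro tendsto_sum tendsto_mult tendsto_const trunc_mzv_tendsto_mzv)
  fix w assume "w \<in> Poly_Mapping.keys x"
  with assms have w: "letters w = [] \<or> hd (letters w) = E1 \<and> last (letters w) = E0"
    by (simp add: H0_iff)
  let ?ks = "index_of (letters w)"
  have pos: "pos_index ?ks" by (rule pos_index_index_of)
  have iw: "index_word ?ks = letters w"
    using w by (intro index_word_index_of) auto
  show "admissible ?ks"
  proof (cases "?ks = []")
    case False
    with iw have "letters w \<noteq> []" by auto
    with w iw have "last (index_word ?ks) = E0" by simp
    then have "\<not> ends_in_one ?ks"
      using last_index_word[OF pos False] by auto
    moreover have "1 \<le> last ?ks"
      using pos False by (simp add: pos_index_def)
    ultimately have "2 \<le> last ?ks"
      using False by (simp add: ends_in_one_def)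
    then show ?thesis
      using pos by (simp add: admissible_def pos_index_def)
  qed (simp add: admissible_def)
qed

section \<open>Splitting off the trailing ones\<close>

text \<open>Chosen so that \<open>({1}\<^sup>a, 2, {1}\<^sup>c)\<close> is the stuffle convolution of the words \<open>{1}\<^sup>s\<close> with the
  \<open>tail_word a j\<close>, \<open>s + j = c\<close>.\<close>

function tail_word :: "nat \<Rightarrow> nat \<Rightarrow> hoffman" where
  "tail_word a j = zmon (replicate a 1 @ 2 # replicate j 1)
     - (\<Sum>i\<in>{..<j}. stuffle_prod (zmon (replicate (j - i) 1)) (tail_word a i))"
  by auto
termination by (relation "Wellfounded.measure snd") auto

declare tail_word.simps [simp del]

lemma tail_word_in_H1: "tail_word a j \<in> H1"
  by (subst tail_word.simps) (intro H1_diff H1_sum zmon_in_H1 stuffle_prod_zmon_in_H1; simp)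

text \<open>The defining recursion solved for its leading term; the summand \<open>i = c\<close> is
  the product with the empty word.\<close>

lemma zmon_ones_two_ones:
  "zmon (replicate a 1 @ 2 # replicate c 1) =
    (\<Sum>i\<le>c. stuffle_prod (zmon (replicate (c - i) 1)) (tail_word a i))"
proof -
  have "{..c} = insert c {..<c}" by auto
  then have "(\<Sum>i\<le>c. stuffle_prod (zmon (replicate (c - i) 1)) (tail_word a i)) =
      tail_word a c + (\<Sum>i\<in>{..<c}. stuffle_prod (zmon (replicate (c - i) 1)) (tail_word a i))"
    using stuffle_prod_Nil_left[OF tail_word_in_H1] by simp
  then show ?thesis
    by (simp add: tail_word.simps[of a c])
qed

text \<open>The derivation turns \<open>{1}^n\<close> into \<open>{1}^(n - 1)\<close> and kills the
  earlier \<open>tail_word a i\<close> by induction. What remains of the subtracted sum is the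
  decomposition of \<open>({1}^a, 2, {1}^(j - 1))\<close>, which is also the image of the leading
  monomial.\<close>

lemma strip_one_tail_word: "strip_one (tail_word a j) = 0"
proof (induction j rule: less_induct)
  case (less j)
  have e: "ends_in_one (replicate n 1) \<longleftrightarrow> n \<noteq> 0" "butlast (replicate n 1) = replicate (n - 1) 1" for n :: nat
    by (auto simp: ends_in_one_def butlast_conv_take)
  have step: "strip_one (stuffle_prod (zmon (replicate (j - i) 1)) (tail_word a i)) =
      stuffle_prod (zmon (replicate (j - 1 - i) 1)) (tail_word a i)" if "i < j" for i
    using strip_one_stuffle_prod[of "replicate (j - i) 1" "tail_word a i"] that less.IH[OF that]
    by (simp add: tail_word_in_H1 e stuffle_prod_0_right del: One_nat_def) 
       (simp add: stuffle_prod_0_right)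
  have "strip_one (tail_word a j) = strip_one (zmon (replicate a 1 @ 2 # replicate j 1))
      - (\<Sum>i\<in>{..<j}. strip_one (stuffle_prod (zmon (replicate (j - i) 1)) (tail_word a i)))"
    by (subst tail_word.simps) (simp add: strip_one_def scal.lin_diff scal.lin_sum)
  also have "(\<Sum>i\<in>{..<j}. strip_one (stuffle_prod (zmon (replicate (j - i) 1)) (tail_word a i))) =
      (\<Sum>i\<in>{..<j}. stuffle_prod (zmon (replicate (j - 1 - i) 1)) (tail_word a i))"
    by (intro sum.cong refl step) simp
  also have "strip_one (zmon (replicate a 1 @ 2 # replicate j 1)) = \<dots>"
  proof (cases j)
    \<comment> \<open>Here the leading monomial ends in 2 and the subtracted sum is empty.\<close>
    case 0
    then show ?thesis
      by (simp add: strip_one_zmon ends_in_one_def)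
  next
    case (Suc n)
    have "replicate a 1 @ 2 # replicate j 1 = (replicate a 1 @ 2 # replicate n 1) @ [1::nat]"
      using Suc by (simp add: replicate_append_same)
    then have "strip_one (zmon (replicate a 1 @ 2 # replicate j 1)) = zmon (replicate a 1 @ 2 # replicate n 1)"
      by (subst strip_one_zmon) (auto simp: ends_in_one_def butlast_append)
    then show ?thesis
      unfolding zmon_ones_two_ones using Suc by (simp add: lessThan_Suc_atMost)
  qed
  finally show ?case by simp
qed

lemma tail_word_in_H0: "tail_word a j \<in> H0"
  by (rule strip_one_eq_0_imp_H0[OF tail_word_in_H1 strip_one_tail_word])

text \<open>Truncated evaluation is a stuffle homomorphism, so \<open>tail_word\<close> inherits the
  recursion which \<open>trunc_mzv_ones_two_ones\<close> gives for \<open>tail_sum\<close>.\<close>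

lemma trunc_eval_tail_word: "trunc_eval M (tail_word a j) = tail_sum M a j"
proof (induction j rule: less_induct)
  case (less j)
  have "trunc_eval M (tail_word a j) = trunc_eval M (zmon (replicate a 1 @ 2 # replicate j 1))
      - (\<Sum>i\<in>{..<j}. trunc_eval M (zmon (replicate (j - i) 1)) * trunc_eval M (tail_word a i))"
    by (subst tail_word.simps)
      (simp add: trunc_eval_stuffle_prod[symmetric], simp add: trunc_eval_def real.lin_diff real.lin_sum)
  also have "\<dots> = trunc_mzv 0 M (replicate a 1 @ 2 # replicate j 1)
      - (\<Sum>i\<in>{..<j}. trunc_mzv 0 M (replicate (j - i) 1) * tail_sum M a i)"
    using less by (simp add: trunc_eval_zmon)
  also have "trunc_mzv 0 M (replicate a 1 @ 2 # replicate j 1) =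
      (\<Sum>i\<le>j. trunc_mzv 0 M (replicate (j - i) 1) * tail_sum M a i)"
    unfolding trunc_mzv_ones_two_ones
    by (rule sum.reindex_bij_witness[of _ "\<lambda>i. j - i" "\<lambda>i. j - i"]) auto
  also have "{..j} = insert j {..<j}" by auto
  finally show ?case by simp
qed

lemma Zeval_tail_word:
  "Zeval (tail_word a j) = (-1) ^ j * real ((a + j + 1) choose j) * mzv [a + j + 2]"
  by (rule LIMSEQ_unique[OF trunc_eval_tendsto_Zeval[OF tail_word_in_H0, unfolded trunc_eval_tail_word]
        tail_sum_tendsto])

section \<open>Newton's identities\<close>

text \<open>A single entry stuffled into a constant index is either inserted at one of
  \<open>n + 1\<close> places or merged with one of the \<open>n\<close> entries.\<close>

lemma sum_stuffle_replicate:
  fixes g :: "nat list \<Rightarrow> real"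
  shows "sum_list (map g (stuffle_lists [k] (replicate n r))) =
    (\<Sum>j\<le>n. g (replicate j r @ k # replicate (n - j) r))
    + (\<Sum>j<n. g (replicate j r @ (k + r) # replicate (n - 1 - j) r))"
proof (induction n arbitrary: g)
  case (Suc n)
  have "sum_list (map g (stuffle_lists [k] (replicate (Suc n) r))) =
      g (k # replicate (Suc n) r) + sum_list (map (\<lambda>ms. g (r # ms)) (stuffle_lists [k] (replicate n r)))
      + g ((k + r) # replicate n r)"
    by (simp add: comp_def)
  also have "sum_list (map (\<lambda>ms. g (r # ms)) (stuffle_lists [k] (replicate n r))) =
      (\<Sum>j\<le>n. g (replicate (Suc j) r @ k # replicate (Suc n - Suc j) r))
      + (\<Sum>j<n. g (replicate (Suc j) r @ (k + r) # replicate (n - Suc j) r))"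
    by (subst Suc.IH) simp
  finally show ?case
    by (simp add: sum.atMost_Suc_shift sum.lessThan_Suc_shift del: sum.atMost_Suc sum.lessThan_Suc)
qed simp

lemma alternating_sum_telescope:
  fixes b :: "nat \<Rightarrow> real"
  shows "(\<Sum>i<n. (-1) ^ i * (b i + b (Suc i))) = b 0 - (-1) ^ n * b n"
  by (induction n) (simp_all add: algebra_simps)

text \<open>\<open>{r}^n\<close> acts as elementary symmetric function and \<open>[r * i]\<close> as
  power sum. A general functional \<open>g\<close> covers the truncated sums for
  \<open>r = 2\<close> and the regularized values for \<open>r = 1\<close>.\<close>

lemma newton_stuffle:
  fixes g :: "nat list \<Rightarrow> real"
  assumes r: "1 \<le> r"
    and hom: "\<And>k n. 1 \<le> k \<Longrightarrow>
      sum_list (map g (stuffle_lists [k] (replicate n r))) = g [k] * g (replicate n r)"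
  shows "real n * g (replicate n r) =
    (\<Sum>i<n. (-1) ^ i * g [r * Suc i] * g (replicate (n - 1 - i) r))"
proof -
  \<comment> \<open>\<open>b i\<close> collects all ways of replacing one entry of
    \<open>{r}^(n - i)\<close> by \<open>r * (i + 1)\<close>. Setting it to 0 from \<open>n\<close>
    on removes the far end of the telescoping sum.\<close>
  define b where "b i = (if i < n then \<Sum>j\<le>n - 1 - i. g (replicate j r @ (r * Suc i) # replicate (n - 1 - i - j) r) else 0)" for i
  have prod: "g [r * Suc i] * g (replicate (n - 1 - i) r) = b i + b (Suc i)" if "i < n" for i
  proof -
    have "(\<Sum>j<n - 1 - i. g (replicate j r @ (r * Suc i + r) # replicate (n - 1 - i - 1 - j) r)) = b (Suc i)"
    proof (cases "Suc i < n")
      case True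
      then have "{..<n - 1 - i} = {..n - 1 - Suc i}" by auto
      then show ?thesis using True by (simp add: b_def add.commute)
    next
      case False
      then show ?thesis by (simp add: b_def)
    qed
    moreover have "1 \<le> r * Suc i" using r by simp
    ultimately show ?thesis
      using that hom[of "r * Suc i" "n - 1 - i", symmetric] unfolding sum_stuffle_replicate
      by (simp add: b_def)
  qed
  have "(\<Sum>i<n. (-1) ^ i * g [r * Suc i] * g (replicate (n - 1 - i) r)) =
      (\<Sum>i<n. (-1) ^ i * (b i + b (Suc i)))"
    by (intro sum.cong refl) (simp only: mult.assoc prod lessThan_iff)
  also have "\<dots> = b 0"
    unfolding alternating_sum_telescope by (simp add: b_def)
  also have "b 0 = real n * g (replicate n r)"
  proof (cases n)
    case (Suc m)
    have "replicate j r @ r # replicate (m - j) r = replicate n r" if "j \<le> m" for j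
    proof -
      have "replicate j r @ r # replicate (m - j) r = replicate j r @ replicate (Suc (m - j)) r"
        by simp
      also have "\<dots> = replicate n r"
        unfolding replicate_add[symmetric] using that Suc by simp
      finally show ?thesis .
    qed
    then show ?thesis using Suc by (simp add: b_def)
  qed (simp add: b_def)
  finally show ?thesis ..
qed

section \<open>Zeta values at even integers\<close>

lemma admissible_twos: "admissible (replicate n 2)"
  by (cases "n = 0") (auto simp: admissible_def)

lemma trunc_twos_power_series:
  "(\<lambda>n. trunc_mzv 0 (Suc N) (replicate n 2) * t ^ n) sums (\<Prod>k=1..N. 1 + t / real k ^ 2)"
proof (induction N)
  case 0
  have "trunc_mzv 0 (Suc 0) (replicate n 2) * t ^ n = (if n = 0 then 1 else 0)" for n
    by (cases n) (simp_all add: trunc_mzv.simps)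
  then show ?case
    using sums_single[of 0 "\<lambda>_. 1::real"] by simp
next
  case (Suc N)
  let ?e = "\<lambda>m n. trunc_mzv 0 m (replicate n 2)"
  let ?P = "\<Prod>k=1..N. 1 + t / real k ^ 2"
  have rec: "?e (Suc (Suc N)) (Suc n) = ?e (Suc N) (Suc n) + ?e (Suc N) n / real (Suc N) ^ 2" for n
    using trunc_mzv_snoc_Suc[of N "replicate n 2" 2] by (simp add: replicate_append_same)
  have "(\<lambda>n. ?e (Suc N) (Suc n) * t ^ Suc n) sums (?P - 1)"
    using Suc.IH by (subst sums_Suc_iff) simp
  moreover have "(\<lambda>n. ?e (Suc N) n * t ^ n * (t / real (Suc N) ^ 2)) sums (?P * (t / real (Suc N) ^ 2))"
    by (intro sums_mult2 Suc.IH)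
  ultimately have "(\<lambda>n. ?e (Suc N) (Suc n) * t ^ Suc n + ?e (Suc N) n * t ^ n * (t / real (Suc N) ^ 2))
      sums (?P - 1 + ?P * (t / real (Suc N) ^ 2))"
    by (rule sums_add)
  moreover have "?e (Suc N) (Suc n) * t ^ Suc n + ?e (Suc N) n * t ^ n * (t / real (Suc N) ^ 2) =
      ?e (Suc (Suc N)) (Suc n) * t ^ Suc n" for n
    unfolding rec by (simp add: distrib_right)
  ultimately have "(\<lambda>n. ?e (Suc (Suc N)) (Suc n) * t ^ Suc n) sums (?P - 1 + ?P * (t / real (Suc N) ^ 2))"
    by (simp only:)
  then have "(\<lambda>n. ?e (Suc (Suc N)) n * t ^ n) sums (?P + ?P * (t / real (Suc N) ^ 2))"
    by (subst (asm) sums_Suc_iff) simp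
  moreover have "?P + ?P * (t / real (Suc N) ^ 2) = (\<Prod>k=1..Suc N. 1 + t / real k ^ 2)"
    by (simp add: distrib_left)
  ultimately show ?case by (simp only:)
qed

text \<open>Euler's sine product at an imaginary argument. The plus signs keep all coefficients
  nonnegative, as the interchange of sums requires.\<close>

lemma sinh_product_formula:
  fixes s :: real
  assumes "s \<noteq> 0"
  shows "(\<lambda>n. \<Prod>k=1..n. 1 + s\<^sup>2 / real k ^ 2) \<longlonglongrightarrow> sinh (pi * s) / (pi * s)"
proof -
  have "(\<lambda>n. of_real pi * (\<i> * of_real s) * (\<Prod>k=1..n. 1 - (\<i> * of_real s)^2 / of_nat k^2))
      \<longlonglongrightarrow> sin (of_real pi * (\<i> * of_real s) :: complex)"
    by (rule sin_product_formula_complex)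
  moreover have "sin (of_real pi * (\<i> * of_real s) :: complex) = \<i> * of_real (sinh (pi * s))"
  proof -
    have "exp (of_real pi * of_real s :: complex) = of_real (exp (pi * s))"
      by (simp only: exp_of_real flip: of_real_mult)
    then show ?thesis
      using sin_i_times[of "of_real (pi * s)"] by (simp add: sinh_field_def exp_minus mult_ac)
  qed
  moreover have "of_real pi * (\<i> * of_real s) * (\<Prod>k=1..n. 1 - (\<i> * of_real s)^2 / of_nat k^2) =
      \<i> * of_real (pi * s * (\<Prod>k=1..n. 1 + s\<^sup>2 / real k ^ 2))" for n
    by (simp add: power_mult_distrib)
  ultimately have lim: "(\<lambda>n. \<i> * of_real (pi * s * (\<Prod>k=1..n. 1 + s\<^sup>2 / real k ^ 2)))
      \<longlonglongrightarrow> \<i> * of_real (sinh (pi * s))"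
    by (simp only:)
  have "Im (\<i> * of_real r) = r" for r
    by simp
  with tendsto_Im[OF lim] have "(\<lambda>n. pi * s * (\<Prod>k=1..n. 1 + s\<^sup>2 / real k ^ 2)) \<longlonglongrightarrow> sinh (pi * s)"
    by (simp only:)
  from tendsto_divide[OF this tendsto_const[of "pi * s"]] show ?thesis
    using assms by simp
qed

lemma sinh_power_series: "(\<lambda>n. x ^ (2 * n + 1) / fact (2 * n + 1)) sums sinh (x :: real)"
proof -
  have "(\<lambda>n. if even n then 0 else x ^ n /\<^sub>R fact n) sums sinh x"
    by (rule sinh_converges)
  then have "(\<lambda>n. (if even (2 * n + 1) then 0 else x ^ (2 * n + 1) /\<^sub>R fact (2 * n + 1))) sums sinh x"
    by (subst sums_mono_reindex[of "\<lambda>n. 2 * n + 1"])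
      (auto simp: strict_mono_def image_iff elim!: oddE)
  then show ?thesis
    by (simp add: divide_inverse mult.commute del: fact_Suc)
qed

text \<open>Comparison of the coefficients of \<open>t ^ n\<close> in the product and the power
  series for \<open>sinh (pi * s) / (pi * s)\<close>, where \<open>t\<close> is the square of
  \<open>s\<close>.\<close>

lemma mzv_twos: "mzv (replicate n 2) = pi ^ (2 * n) / fact (2 * n + 1)"
proof -
  let ?e = "\<lambda>N n. trunc_mzv 0 (Suc N) (replicate n 2)"
  \<comment> \<open>The value at \<open>N = 0\<close>. The limit in \<open>N\<close> is written as a
    telescoping series of nonnegative increments, which leaves this initial value to be
    subtracted.\<close>
  let ?d = "\<lambda>n::nat. if n = 0 then 1 else (0::real)"
  define a where "a n = mzv (replicate n 2) - ?d n" for n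
  define b where "b n = pi ^ (2 * n) / fact (2 * n + 1) - ?d n" for n
  have col: "(\<lambda>N. ?e (Suc N) n - ?e N n) sums a n" for n
  proof -
    have "?e 0 n = ?d n"
      by (cases n) (simp_all add: trunc_mzv.simps)
    moreover have "(\<lambda>N. ?e N n) \<longlonglongrightarrow> mzv (replicate n 2)"
      by (intro LIMSEQ_Suc trunc_mzv_tendsto_mzv admissible_twos)
    ultimately show ?thesis
      using telescope_sums[of "\<lambda>N. ?e N n"] by (simp add: a_def)
  qed
  have "\<exists>S. (\<lambda>n. a n * t ^ n) sums S \<and> (\<lambda>n. b n * t ^ n) sums S" if t: "0 < t" "t < 1" for t
  proof -
    define s where "s = sqrt t"
    have s: "s \<noteq> 0" "s\<^sup>2 = t" using t by (auto simp: s_def)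
    let ?P = "\<lambda>N. \<Prod>k=1..N. 1 + t / real k ^ 2"
    let ?L = "sinh (pi * s) / (pi * s)"
    have mono: "?e N n \<le> ?e (Suc N) n" for N n
      by (rule trunc_mzv_mono_bound) simp
    have "(\<lambda>n. suminf (\<lambda>N. (?e (Suc N) n - ?e N n) * t ^ n)) sums (?L - 1)"
    proof (rule sums_swap_nonneg(2))
      show "0 \<le> (?e (Suc N) n - ?e N n) * t ^ n" for N n
        using mono[of N n] t by simp
      show "(\<lambda>n. (?e (Suc N) n - ?e N n) * t ^ n) sums (?P (Suc N) - ?P N)" for N
        unfolding left_diff_distrib by (intro sums_diff trunc_twos_power_series)
      have "?P \<longlonglongrightarrow> ?L"
        using sinh_product_formula[OF s(1)] by (simp only: s(2))
      from telescope_sums[OF this] show "(\<lambda>N. ?P (Suc N) - ?P N) sums (?L - 1)"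
        by simp
    qed
    moreover have "suminf (\<lambda>N. (?e (Suc N) n - ?e N n) * t ^ n) = a n * t ^ n" for n
      using sums_mult2[OF col[of n], of "t ^ n"] by (simp add: sums_iff)
    ultimately have "(\<lambda>n. a n * t ^ n) sums (?L - 1)"
      by (simp only:)
    moreover have "(\<lambda>n. b n * t ^ n) sums (?L - 1)"
    proof -
      have "(\<lambda>n. (pi * s) ^ (2 * n + 1) / fact (2 * n + 1) / (pi * s)) sums ?L"
        by (intro sums_divide sinh_power_series)
      moreover have "(pi * s) ^ (2 * n + 1) / fact (2 * n + 1) / (pi * s) =
          pi ^ (2 * n) / fact (2 * n + 1) * t ^ n" for n
        using s by (simp add: power_mult_distrib power_mult del: fact_Suc)
      moreover have "(\<lambda>n. ?d n * t ^ n) sums 1"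
        using sums_single[of 0 "\<lambda>n. t ^ n"] by (simp add: if_distrib[of "\<lambda>x. x * _"] cong: if_cong)
      ultimately show ?thesis
        unfolding b_def left_diff_distrib by (intro sums_diff) simp_all
    qed
    ultimately show ?thesis by blast
  qed
  then have "a = b"
    by (rule powser_unique_right[OF zero_less_one])
  then show ?thesis
    by (auto simp: a_def b_def fun_eq_iff dest: spec[of _ n])
qed

text \<open>Newton's identities for \<open>r = 2\<close> in the limit: a recursion for the even zeta
  values with rational multiples of powers of \<open>pi^2\<close> as coefficients.\<close>

lemma newton_zeta_even:
  "real n * (pi ^ (2 * n) / fact (2 * n + 1)) =
    (\<Sum>i<n. (-1) ^ i * mzv [2 * Suc i] * (pi ^ (2 * (n - 1 - i)) / fact (2 * (n - 1 - i) + 1)))"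
proof -
  have lim: "(\<lambda>M. trunc_mzv 0 M (replicate m 2)) \<longlonglongrightarrow> pi ^ (2 * m) / fact (2 * m + 1)" for m
    unfolding mzv_twos[symmetric] by (intro trunc_mzv_tendsto_mzv admissible_twos)
  have lim': "(\<lambda>M. trunc_mzv 0 M [2 * Suc i]) \<longlonglongrightarrow> mzv [2 * Suc i]" for i
    by (intro trunc_mzv_tendsto_mzv) (auto simp: admissible_def)
  have newton: "real n * trunc_mzv 0 M (replicate n 2) =
      (\<Sum>i<n. (-1) ^ i * trunc_mzv 0 M [2 * Suc i] * trunc_mzv 0 M (replicate (n - 1 - i) 2))" for M
    by (rule newton_stuffle) (simp_all add: trunc_mzv_stuffle)
  have "(\<lambda>M. real n * trunc_mzv 0 M (replicate n 2)) \<longlonglongrightarrow> real n * (pi ^ (2 * n) / fact (2 * n + 1))"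
    by (intro tendsto_mult tendsto_const lim)
  moreover have "(\<lambda>M. real n * trunc_mzv 0 M (replicate n 2)) \<longlonglongrightarrow>
      (\<Sum>i<n. (-1) ^ i * mzv [2 * Suc i] * (pi ^ (2 * (n - 1 - i)) / fact (2 * (n - 1 - i) + 1)))"
    unfolding newton by (intro tendsto_sum tendsto_mult tendsto_const lim lim')
  ultimately show ?thesis by (rule LIMSEQ_unique)
qed

section \<open>Closure properties of the rational subalgebra, and even zeta values\<close>

lemma rat_subalgebra_uminus: "x \<in> rat_subalgebra G \<Longrightarrow> - x \<in> rat_subalgebra G"
  using rat_subalgebra.intros(4)[OF rat_subalgebra.intros(1)[of "-1"], of x G] by simp

lemma rat_subalgebra_diff: "x \<in> rat_subalgebra G \<Longrightarrow> y \<in> rat_subalgebra G \<Longrightarrow> x - y \<in> rat_subalgebra G"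
  using rat_subalgebra.intros(3)[of x G "- y"] rat_subalgebra_uminus by simp

lemma rat_subalgebra_of_nat: "real n \<in> rat_subalgebra G"
  using rat_subalgebra.intros(1)[of "of_nat n" G] by simp

lemma rat_subalgebra_sum: "(\<And>i. i \<in> I \<Longrightarrow> f i \<in> rat_subalgebra G) \<Longrightarrow> sum f I \<in> rat_subalgebra G"
  using rat_subalgebra_of_nat[of 0 G]
  by (induction I rule: infinite_finite_induct) (auto intro: rat_subalgebra.intros)

lemma rat_subalgebra_prod: "(\<And>i. i \<in> I \<Longrightarrow> f i \<in> rat_subalgebra G) \<Longrightarrow> prod f I \<in> rat_subalgebra G"
  using rat_subalgebra_of_nat[of 1 G]
  by (induction I rule: infinite_finite_induct) (auto intro: rat_subalgebra.intros)

lemma rat_subalgebra_power: "x \<in> rat_subalgebra G \<Longrightarrow> x ^ n \<in> rat_subalgebra G"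
  using rat_subalgebra_prod[of "{..<n}" "\<lambda>_. x" G] by simp

lemma rat_subalgebra_divide_nat: "x \<in> rat_subalgebra G \<Longrightarrow> x / real n \<in> rat_subalgebra G"
  using rat_subalgebra.intros(4)[OF rat_subalgebra.intros(1)[of "1 / of_nat n"], of x G]
  by (simp add: of_rat_divide)

text \<open>The last term of \<open>newton_zeta_even\<close> is \<open>\<zeta>(2n)\<close> up to
  sign; solving for it leaves \<open>pi^2\<close> and smaller even zeta values.\<close>

lemma zeta_even_in_rat_subalgebra:
  assumes "pi\<^sup>2 \<in> G"
  shows "1 \<le> n \<Longrightarrow> mzv [2 * n] \<in> rat_subalgebra G"
proof (induction n rule: less_induct)
  case (less n)
  let ?c = "\<lambda>m. pi ^ (2 * m) / fact (2 * m + 1)"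
  have c: "?c m \<in> rat_subalgebra G" for m
    using rat_subalgebra_divide_nat[OF rat_subalgebra_power[OF rat_subalgebra.intros(2)[OF assms], of m],
        of "fact (2 * m + 1)"]
    by (simp add: power_mult del: fact_Suc)
  have sign: "(-1 :: real) ^ i \<in> rat_subalgebra G" for i
    using rat_subalgebra_of_nat[of 1 G] by (intro rat_subalgebra_power rat_subalgebra_uminus) simp
  let ?t = "\<lambda>i. (-1) ^ i * mzv [2 * Suc i] * ?c (n - 1 - i)"
  obtain k where n: "n = Suc k" using less.prems by (cases n) auto
  have "real n * ?c n = (\<Sum>i<k. ?t i) + (-1) ^ k * mzv [2 * n]"
    using newton_zeta_even[of n] by (simp add: n)
  then have "mzv [2 * n] = (-1) ^ k * (real n * ?c n - (\<Sum>i<k. ?t i))"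
    by (simp add: mult.assoc[symmetric] flip: power_add mult_2)
  also have "\<dots> \<in> rat_subalgebra G"
  proof (intro rat_subalgebra.intros(4)[of "(-1) ^ k"] rat_subalgebra_diff rat_subalgebra_sum sign)
    show "real n * ?c n \<in> rat_subalgebra G"
      by (intro rat_subalgebra.intros(4) rat_subalgebra_of_nat c)
    show "?t i \<in> rat_subalgebra G" if "i \<in> {..<k}" for i
      using that less.IH[of "Suc i"] n by (intro rat_subalgebra.intros(4) sign c) auto
  qed
  finally show ?case .
qed

section \<open>The sequence \<open>Cseq\<close>\<close>

text \<open>The bound \<open>N\<close> on the parts is kept apart from the weight \<open>s\<close>,
  so that \<open>s\<close> can be lowered with \<open>N\<close> fixed.\<close>

definition exp_index :: "nat \<Rightarrow> nat \<Rightarrow> (nat \<Rightarrow> nat) set" where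
  "exp_index N s = {k \<in> {2..N} \<rightarrow>\<^sub>E UNIV. (\<Sum>i=2..N. i * k i) = s}"

definition exp_weight :: "(nat \<Rightarrow> real) \<Rightarrow> nat \<Rightarrow> (nat \<Rightarrow> nat) \<Rightarrow> real" where
  "exp_weight t N k = (\<Prod>i=2..N. t i ^ k i / fact (k i))"

text \<open>The coefficient of \<open>X ^ s\<close> in the exponential of the sum of \<open>t i * X ^ i\<close> over \<open>2 \<le> i \<le> N\<close>.\<close>

definition exp_coeff :: "(nat \<Rightarrow> real) \<Rightarrow> nat \<Rightarrow> nat \<Rightarrow> real" where
  "exp_coeff t N s = sum (exp_weight t N) (exp_index N s)"

lemma finite_exp_index: "finite (exp_index N s)"
proof (rule finite_subset)
  show "exp_index N s \<subseteq> {2..N} \<rightarrow>\<^sub>E {..s}"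
  proof
    fix k assume k: "k \<in> exp_index N s"
    have "k i \<le> s" if "i \<in> {2..N}" for i
    proof -
      have "k i \<le> i * k i" using that by simp
      also have "\<dots> \<le> (\<Sum>i=2..N. i * k i)"
        using that by (intro member_le_sum) auto
      finally show ?thesis using k by (simp add: exp_index_def)
    qed
    then show "k \<in> {2..N} \<rightarrow>\<^sub>E {..s}"
      using k by (auto simp: exp_index_def PiE_def Pi_def)
  qed
  show "finite ({2..N} \<rightarrow>\<^sub>E {..s})" by (intro finite_PiE) auto
qed

lemma exp_weight_update:
  assumes "i \<in> {2..N}"
  shows "real (Suc (k i)) * exp_weight t N (k(i := Suc (k i))) = t i * exp_weight t N k"
proof -
  have split: "exp_weight t N f = t i ^ f i / fact (f i) * (\<Prod>j\<in>{2..N} - {i}. t j ^ f j / fact (f j))" for f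
    unfolding exp_weight_def by (rule prod.remove) (use assms in auto)
  have "(\<Prod>j\<in>{2..N} - {i}. t j ^ (k(i := Suc (k i))) j / fact ((k(i := Suc (k i))) j)) =
      (\<Prod>j\<in>{2..N} - {i}. t j ^ k j / fact (k j))"
    by (rule prod.cong) auto
  then show ?thesis
    unfolding split by (simp add: fact_Suc mult.assoc del: of_nat_Suc)
qed

lemma exp_index_update:
  fixes N n :: nat and k :: "nat \<Rightarrow> nat"
  assumes "i \<in> {2..N}" "k \<in> {2..N} \<rightarrow>\<^sub>E UNIV"
  shows "(\<Sum>j=2..N. j * (k(i := n)) j) + i * k i = (\<Sum>j=2..N. j * k j) + i * n"
proof -
  have "(\<Sum>j=2..N. j * f j) = i * f i + (\<Sum>j\<in>{2..N} - {i}. j * f j)" for f :: "nat \<Rightarrow> nat"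
    by (rule sum.remove) (use assms in auto)
  moreover have "(\<Sum>j\<in>{2..N} - {i}. j * (k(i := n)) j) = (\<Sum>j\<in>{2..N} - {i}. j * k j)"
    by (rule sum.cong) auto
  ultimately show ?thesis by simp
qed

text \<open>Lowering \<open>k i\<close> by one is a bijection from the exponents with
  \<open>k i \<ge> 1\<close> onto those of weight \<open>s - i\<close>, and the factor
  \<open>k i\<close> cancels against the factorial.\<close>

lemma sum_exp_index_weighted:
  assumes i: "i \<in> {2..N}"
  shows "(\<Sum>k\<in>exp_index N s. real (k i) * exp_weight t N k) =
    (if i \<le> s then t i * exp_coeff t N (s - i) else 0)"
proof -
  let ?K = "{k \<in> exp_index N s. 1 \<le> k i}"
  have "(\<Sum>k\<in>exp_index N s. real (k i) * exp_weight t N k) = (\<Sum>k\<in>?K. real (k i) * exp_weight t N k)"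
    by (rule sum.mono_neutral_right) (auto simp: finite_exp_index not_less_eq_eq)
  also have "\<dots> = (if i \<le> s then t i * exp_coeff t N (s - i) else 0)"
  proof (cases "i \<le> s")
    case True
    have "(\<Sum>k\<in>?K. real (k i) * exp_weight t N k) = (\<Sum>k\<in>exp_index N (s - i). t i * exp_weight t N k)"
    proof (rule sum.reindex_bij_witness[where i = "\<lambda>k. k(i := Suc (k i))" and j = "\<lambda>k. k(i := k i - 1)"])
      fix k assume k: "k \<in> ?K"
      then show "(k(i := k i - 1))(i := Suc ((k(i := k i - 1)) i)) = k" by auto
      have kP: "k \<in> {2..N} \<rightarrow>\<^sub>E UNIV" and sum: "(\<Sum>j=2..N. j * k j) = s" and k1: "1 \<le> k i"
        using k by (auto simp: exp_index_def)
      have "i * k i = i * (k i - 1) + i"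
        using k1 by (cases "k i") auto
      then have "(\<Sum>j=2..N. j * (k(i := k i - 1)) j) = s - i"
        using exp_index_update[OF i kP, of "k i - 1"] sum by linarith
      then show "k(i := k i - 1) \<in> exp_index N (s - i)"
        using kP i by (auto simp: exp_index_def PiE_def extensional_def)
      show "t i * exp_weight t N (k(i := k i - 1)) = real (k i) * exp_weight t N k"
        using exp_weight_update[OF i, of "k(i := k i - 1)" t] k1 by simp
    next
      fix k assume k: "k \<in> exp_index N (s - i)"
      then show "(k(i := Suc (k i)))(i := (k(i := Suc (k i))) i - 1) = k" by auto
      have kP: "k \<in> {2..N} \<rightarrow>\<^sub>E UNIV" and sum: "(\<Sum>j=2..N. j * k j) = s - i"
        using k by (auto simp: exp_index_def)
      have "(\<Sum>j=2..N. j * (k(i := Suc (k i))) j) = s"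
        using exp_index_update[OF i kP, of "Suc (k i)"] sum True by simp
      then show "k(i := Suc (k i)) \<in> ?K"
        using kP i by (auto simp: exp_index_def PiE_def extensional_def)
    qed
    then show ?thesis using True by (simp add: exp_coeff_def sum_distrib_left)
  next
    case False
    have "?K = {}"
    proof -
      have "k i = 0" if "k \<in> exp_index N s" for k
      proof -
        have "i * k i \<le> (\<Sum>j=2..N. j * k j)"
          using i by (intro member_le_sum) auto
        moreover have "(\<Sum>j=2..N. j * k j) = s"
          using that by (simp add: exp_index_def)
        ultimately have "i * k i < i * 1" using False by linarith
        then show ?thesis by (simp only: mult_less_cancel1) simp
      qed
      then show ?thesis by force
    qed
    then show ?thesis using False by (simp only: sum.empty if_False)
  qed
  finally show ?thesis .
qed

text \<open>The identity \<open>E' = T' * E\<close> for the exponential \<open>E\<close> of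
  \<open>T\<close>, coefficientwise: the weight \<open>s\<close> is distributed as the sum of
  \<open>i * k i\<close>.\<close>

lemma exp_coeff_rec:
  "real s * exp_coeff t N s = (\<Sum>i\<in>{2..N}. if i \<le> s then real i * t i * exp_coeff t N (s - i) else 0)"
proof -
  have "real s * exp_coeff t N s = (\<Sum>k\<in>exp_index N s. (\<Sum>i=2..N. real i * real (k i)) * exp_weight t N k)"
    unfolding exp_coeff_def sum_distrib_left
  proof (rule sum.cong[OF refl])
    fix k assume "k \<in> exp_index N s"
    then have "real s = real (\<Sum>i=2..N. i * k i)" by (simp add: exp_index_def)
    then show "real s * exp_weight t N k = (\<Sum>i=2..N. real i * real (k i)) * exp_weight t N k"
      by simp
  qed
  also have "\<dots> = (\<Sum>i=2..N. real i * (\<Sum>k\<in>exp_index N s. real (k i) * exp_weight t N k))"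
    unfolding sum_distrib_right sum_distrib_left by (subst sum.swap) (simp add: mult.assoc)
  also have "\<dots> = (\<Sum>i\<in>{2..N}. if i \<le> s then real i * t i * exp_coeff t N (s - i) else 0)"
    by (intro sum.cong refl) (simp add: sum_exp_index_weighted)
  finally show ?thesis .
qed

lemma exp_coeff_0: "exp_coeff t N 0 = 1"
proof -
  have "exp_index N 0 = {\<lambda>i\<in>{2..N}. 0}"
  proof
    show "exp_index N 0 \<subseteq> {\<lambda>i\<in>{2..N}. 0}"
    proof
      fix k assume "k \<in> exp_index N 0"
      then have "k i = (\<lambda>i\<in>{2..N}. 0) i" for i
        by (cases "i \<in> {2..N}") (auto simp: exp_index_def PiE_def extensional_def)
      then show "k \<in> {\<lambda>i\<in>{2..N}. 0}" by (simp add: fun_eq_iff)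
    qed
  qed (auto simp: exp_index_def)
  then show ?thesis
    by (simp add: exp_coeff_def exp_weight_def)
qed

text \<open>Parts larger than \<open>s\<close> do not contribute: for every \<open>N \<ge> s\<close>
  the recursion reduces to the same one.\<close>

lemma exp_coeff_eq:
  "s \<le> N \<Longrightarrow> exp_coeff t N s = exp_coeff t s s"
proof (induction s arbitrary: N rule: less_induct)
  case (less s)
  show ?case
  proof (cases "s = 0")
    case False
    have "real s * exp_coeff t N s = (\<Sum>i\<in>{2..s}. real i * t i * exp_coeff t (s - i) (s - i))" if "s \<le> N" for N
    proof -
      have "(\<Sum>i\<in>{2..N}. if i \<le> s then real i * t i * exp_coeff t N (s - i) else 0) =
          (\<Sum>i\<in>{2..s}. if i \<le> s then real i * t i * exp_coeff t N (s - i) else 0)"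
        by (rule sum.mono_neutral_right) (use that in auto)
      also have "\<dots> = (\<Sum>i\<in>{2..s}. real i * t i * exp_coeff t (s - i) (s - i))"
      proof (rule sum.cong[OF refl])
        fix i assume i: "i \<in> {2..s}"
        then have "exp_coeff t N (s - i) = exp_coeff t (s - i) (s - i)"
          using that by (intro less.IH) auto
        then show "(if i \<le> s then real i * t i * exp_coeff t N (s - i) else 0) =
            real i * t i * exp_coeff t (s - i) (s - i)"
          using i by simp
      qed
      finally show ?thesis unfolding exp_coeff_rec .
    qed
    from this[OF less.prems] this[OF order_refl] show ?thesis
      using False by (metis mult_cancel_left of_nat_eq_0_iff)
  qed (simp add: exp_coeff_0)
qed

text \<open>Thus the generating function of \<open>Cseq\<close> is the exponential of minus the sum
  of \<open>\<zeta>(i) / i * X ^ i\<close> over \<open>i \<ge> 2\<close>.\<close>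

lemma Cseq_eq_exp_coeff: "Cseq s = exp_coeff (\<lambda>i. - (mzv [i] / real i)) s s"
proof -
  \<comment> \<open>For \<open>s = 1\<close> the sum over parts is empty and never equals 1, in
    agreement with the value 0 prescribed for \<open>Cseq 1\<close>.\<close>
  have 1: "exp_index 1 1 = {}" by (auto simp: exp_index_def)
  have "(- 1) ^ (\<Sum>i=2..s. k i) / (\<Prod>i=2..s. fact (k i)) * (\<Prod>i=2..s. (mzv [i] / real i) ^ k i) =
      exp_weight (\<lambda>i. - (mzv [i] / real i)) s k" for k
  proof -
    have "(- (mzv [i] / real i)) ^ k i = (-1) ^ k i * (mzv [i] / real i) ^ k i" for i
      by (rule power_minus)
    then show ?thesis
      by (simp only: exp_weight_def prod_dividef prod.distrib power_sum)
        (simp only: times_divide_eq_left)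
  qed
  then show ?thesis
    using 1 by (auto simp: Cseq_def exp_coeff_0 exp_coeff_def exp_index_def)
qed

lemma Cseq_rec:
  "real s * Cseq s = - (\<Sum>i\<in>{2..s}. mzv [i] * Cseq (s - i))"
proof -
  let ?t = "\<lambda>i. - (mzv [i] / real i)"
  have "real s * Cseq s = (\<Sum>i\<in>{2..s}. if i \<le> s then real i * ?t i * exp_coeff ?t s (s - i) else 0)"
    unfolding Cseq_eq_exp_coeff by (rule exp_coeff_rec)
  also have "\<dots> = (\<Sum>i\<in>{2..s}. - (mzv [i] * Cseq (s - i)))"
    by (intro sum.cong refl) (simp add: Cseq_eq_exp_coeff exp_coeff_eq[of "s - _" s])
  finally show ?thesis by (simp add: sum_negf)
qed

section \<open>Regularized values\<close>

locale regularization =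
  fixes prd :: "hoffman \<Rightarrow> hoffman \<Rightarrow> hoffman" and F :: "hoffman \<Rightarrow> real poly"
  assumes reg: "is_regularization prd F"
begin

definition val :: "hoffman \<Rightarrow> real" where
  "val x = poly (F x) 0"

lemma val_add: "x \<in> H1 \<Longrightarrow> y \<in> H1 \<Longrightarrow> val (x + y) = val x + val y"
  using reg by (simp add: is_regularization_def rat_alg_hom_H1_def val_def)

lemma val_scal_mult: "x \<in> H1 \<Longrightarrow> val (scal q * x) = of_rat q * val x"
  using reg by (simp add: is_regularization_def rat_alg_hom_H1_def val_def)

lemma val_mult: "x \<in> H1 \<Longrightarrow> y \<in> H1 \<Longrightarrow> val (prd x y) = val x * val y"
  using reg by (simp add: is_regularization_def rat_alg_hom_H1_def val_def)

lemma val_H0: "x \<in> H0 \<Longrightarrow> val x = Zeval x"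
  using reg by (simp add: is_regularization_def val_def)

lemma val_zgen_1: "val (zgen 1) = 0"
  using reg by (simp add: is_regularization_def val_def)

lemma val_0: "val 0 = 0"
  using val_scal_mult[of "scal 0" 0] scal_in_H1[of 0] by simp

lemma val_sum: "(\<And>i. i \<in> I \<Longrightarrow> X i \<in> H1) \<Longrightarrow> val (sum X I) = (\<Sum>i\<in>I. val (X i))"
  by (induction I rule: infinite_finite_induct) (auto simp: val_0 val_add H1_sum)

lemma val_sum_list:
  "(\<And>x. x \<in> set xs \<Longrightarrow> x \<in> H1) \<Longrightarrow> val (sum_list xs) = sum_list (map val xs)"
  by (induction xs) (auto simp: val_0 val_add H1_sum_list)

lemma val_zmon_admissible:
  assumes "admissible ks"
  shows "val (zmon ks) = mzv ks"
proof -
  have pos: "pos_index ks" using assms by (simp add: admissible_def pos_index_def)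
  have "zmon ks \<in> H0"
  proof (cases "ks = []")
    case True
    then show ?thesis by (simp add: zmon_eq_single H0_iff index_word_def)
  next
    case False
    then have "last (index_word ks) = E0"
      using assms by (subst last_index_word[OF pos]) (auto simp: admissible_def ends_in_one_def)
    moreover have "hd (index_word ks) = E1"
      using False by (cases ks) (simp_all add: index_word_def)
    ultimately show ?thesis by (simp add: zmon_eq_single H0_iff)
  qed
  then show ?thesis
    using pos by (simp add: val_H0 Zeval_zmon pos_index_def)
qed

end

section \<open>Stuffle regularization\<close>

text \<open>In Newton's identities with \<open>r = 1\<close> the first power sum is
  \<open>val (zgen 1) = 0\<close> and the others are zeta values; the resulting recursion is
  \<open>Cseq_rec\<close> up to the sign \<open>(-1) ^ s\<close>.\<close>

lemma val_stuffle_ones: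
  assumes "regularization stuffle_prod F"
  shows "regularization.val F (zmon (replicate s 1)) = (-1) ^ s * Cseq s"
proof -
  interpret regularization stuffle_prod F by fact
  let ?g = "\<lambda>ks. val (zmon ks)"
  have hom: "sum_list (map ?g (stuffle_lists [k] (replicate n 1))) = ?g [k] * ?g (replicate n 1)"
    if "1 \<le> k" for k n
  proof -
    have "sum_list (map ?g (stuffle_lists [k] (replicate n 1))) = val (stuffle_indices [k] (replicate n 1))"
      unfolding stuffle_indices_eq by (subst val_sum_list) (auto simp: zmon_in_H1 comp_def)
    also have "stuffle_indices [k] (replicate n 1) = stuffle_prod (zmon [k]) (zmon (replicate n 1))"
      using that by (intro stuffle_prod_zmon[symmetric]) auto
    finally show ?thesis by (simp add: val_mult zmon_in_H1)
  qed
  have single: "?g [1 * Suc i] = (if i = 0 then 0 else mzv [Suc i])" for i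
  proof (cases "i = 0")
    case True
    then show ?thesis using val_zgen_1 by (simp add: zmon_def)
  next
    case False
    then show ?thesis using val_zmon_admissible[of "[Suc i]"] by (simp add: admissible_def)
  qed
  show ?thesis
  proof (induction s rule: less_induct)
    case (less s)
    show ?case
    proof (cases s)
      case 0
      have "?g [] = mzv []" by (rule val_zmon_admissible) (simp add: admissible_def)
      also have "mzv [] = 1"
        using trunc_mzv_tendsto_mzv[of "[]"] by (simp add: admissible_def LIMSEQ_const_iff)
      finally show ?thesis using 0 by (simp add: Cseq_def)
    next
      case (Suc m)
      have "real s * ?g (replicate s 1) = (\<Sum>i<s. (-1) ^ i * ?g [1 * Suc i] * ?g (replicate (s - 1 - i) 1))"
        by (rule newton_stuffle[where g = ?g]) (simp_all only: hom order_refl)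
      also have "\<dots> = (\<Sum>i<s. if i = 0 then 0 else (-1) ^ m * (mzv [Suc i] * Cseq (s - Suc i)))"
      proof (rule sum.cong[OF refl])
        fix i assume i: "i \<in> {..<s}"
        then have "?g (replicate (s - 1 - i) 1) = (-1) ^ (s - 1 - i) * Cseq (s - 1 - i)"
          using Suc by (intro less.IH) auto
        moreover have "(-1 :: real) ^ m = (-1) ^ i * (-1) ^ (s - 1 - i)"
          using i Suc by (simp flip: power_add)
        ultimately show "(-1) ^ i * ?g [1 * Suc i] * ?g (replicate (s - 1 - i) 1) =
            (if i = 0 then 0 else (-1) ^ m * (mzv [Suc i] * Cseq (s - Suc i)))"
          unfolding single by simp
      qed
      also have "\<dots> = (\<Sum>i\<in>{1..<s}. (-1) ^ m * (mzv [Suc i] * Cseq (s - Suc i)))"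
        by (rule sum.mono_neutral_cong_right) auto
      also have "\<dots> = (\<Sum>i\<in>{2..s}. (-1) ^ m * (mzv [i] * Cseq (s - i)))"
        by (rule sum.reindex_bij_witness[of _ "\<lambda>i. i - 1" Suc]) auto
      also have "\<dots> = (-1) ^ m * - (real s * Cseq s)"
        unfolding Cseq_rec by (simp add: sum_distrib_left)
      also have "\<dots> = real s * ((-1) ^ s * Cseq s)"
        using Suc by simp
      finally show ?thesis
        using Suc by (simp only: mult_cancel_left of_nat_eq_0_iff) simp
    qed
  qed
qed

text \<open>The regularization is multiplicative on the decomposition
  \<open>zmon_ones_two_ones\<close>; the sign arises as \<open>(-1) ^ (c - i) * (-1) ^ i\<close>
  from the two factors.\<close>

lemma val_stuffle_ones_two_ones:
  assumes "regularization stuffle_prod F"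
  shows "regularization.val F (zmon (replicate a 1 @ [2] @ replicate c 1)) =
    (-1) ^ c * (\<Sum>s=0..c. real ((a + c - s + 1) choose (c - s)) * mzv [a + c - s + 2] * Cseq s)"
proof -
  interpret regularization stuffle_prod F by fact
  have "val (zmon (replicate a 1 @ [2] @ replicate c 1)) =
      (\<Sum>i\<le>c. val (stuffle_prod (zmon (replicate (c - i) 1)) (tail_word a i)))"
    unfolding append.simps zmon_ones_two_ones
    by (rule val_sum) (simp add: stuffle_prod_zmon_in_H1)
  also have "\<dots> = (\<Sum>i\<le>c. (-1) ^ c * (real ((a + i + 1) choose i) * mzv [a + i + 2] * Cseq (c - i)))"
  proof (rule sum.cong[OF refl])
    fix i assume "i \<in> {..c}"
    then have "(-1 :: real) ^ c = (-1) ^ (c - i) * (-1) ^ i"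
      by (simp flip: power_add)
    then show "val (stuffle_prod (zmon (replicate (c - i) 1)) (tail_word a i)) =
        (-1) ^ c * (real ((a + i + 1) choose i) * mzv [a + i + 2] * Cseq (c - i))"
      unfolding val_mult[OF zmon_in_H1 tail_word_in_H1] val_stuffle_ones[OF assms]
        val_H0[OF tail_word_in_H0] Zeval_tail_word by (simp only: mult_ac)
  qed
  also have "\<dots> = (\<Sum>s=0..c. (-1) ^ c * (real ((a + c - s + 1) choose (c - s)) * mzv [a + c - s + 2] * Cseq s))"
    by (rule sum.reindex_bij_witness[of _ "\<lambda>s. c - s" "\<lambda>i. c - i"]) auto
  finally show ?thesis by (simp only: sum_distrib_left)
qed

section \<open>Shuffle regularization\<close>

lemma lett_mult_single: "lett b * Poly_Mapping.single (Word u) q = Poly_Mapping.single (Word (b # u)) q"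
  by (simp add: lett_def mult_single plus_hword_def)

lemma shuffle_words_Nil_right [simp]: "shuffle_words u [] = Poly_Mapping.single (Word u) 1"
  by (cases u) auto

text \<open>All \<open>c + 1\<close> positions of the inserted letter give the same word.\<close>

lemma shuffle_E1_ones:
  "shuffle_words [E1] (replicate c E1) = Poly_Mapping.single (Word (replicate (Suc c) E1)) (of_nat (Suc c))"
proof (induction c)
  case (Suc c)
  have "shuffle_words [E1] (replicate (Suc c) E1) =
      Poly_Mapping.single (Word (replicate (Suc (Suc c)) E1)) 1
      + Poly_Mapping.single (Word (replicate (Suc (Suc c)) E1)) (of_nat (Suc c))"
    by (simp add: Suc[unfolded replicate_Suc] lett_mult_single)
  also have "\<dots> = Poly_Mapping.single (Word (replicate (Suc (Suc c)) E1)) (of_nat (Suc (Suc c)))"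
    unfolding single_add[symmetric] by (simp only: of_nat_Suc)
  finally show ?case .
qed simp

text \<open>\<open>n\<close> counts every \<open>E1\<close> before the \<open>E0\<close>, so the
  index \<open>({1}^a, 2, {1}^c)\<close> corresponds to \<open>n = a + 1\<close>.\<close>

definition one_gap :: "nat \<Rightarrow> nat \<Rightarrow> rat \<Rightarrow> hoffman" where
  "one_gap n c q = Poly_Mapping.single (Word (replicate n E1 @ E0 # replicate c E1)) q"

lemma e1_mult_one_gap: "e1 * one_gap n c q = one_gap (Suc n) c q"
  by (simp add: one_gap_def lett_mult_single)

lemma one_gap_add: "one_gap n c (p + q) = one_gap n c p + one_gap n c q"
  by (simp add: one_gap_def single_add)

text \<open>If \<open>j\<close> of the \<open>c\<close> letters end up before \<open>E0\<close>,
  they interleave with the \<open>n\<close> letters there in \<open>binom(n + j, j)\<close> ways.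
  The induction amounts to Pascal's rule.\<close>

lemma shuffle_one_gap_ones:
  "shuffle_words (replicate n E1 @ [E0]) (replicate c E1) =
    (\<Sum>j\<le>c. one_gap (n + j) (c - j) (of_nat ((n + j) choose j)))"
proof (induction n arbitrary: c)
  case 0
  show ?case
  proof (induction c)
    case (Suc c)
    have "shuffle_words [E0] (replicate (Suc c) E1) =
        one_gap 0 (Suc c) 1 + e1 * shuffle_words [E0] (replicate c E1)"
      by (simp add: lett_mult_single one_gap_def)
    also have "e1 * shuffle_words [E0] (replicate c E1) = (\<Sum>j\<le>c. one_gap (Suc j) (c - j) 1)"
      using Suc by (simp add: sum_distrib_left e1_mult_one_gap)
    finally show ?case
      by (simp add: sum.atMost_Suc_shift del: sum.atMost_Suc)
  qed (simp add: one_gap_def)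
next
  case (Suc n)
  note outer = Suc.IH
  show ?case
  proof (induction c)
    case (Suc c)
    have "shuffle_words (replicate (Suc n) E1 @ [E0]) (replicate (Suc c) E1) =
        e1 * shuffle_words (replicate n E1 @ [E0]) (replicate (Suc c) E1)
        + e1 * shuffle_words (replicate (Suc n) E1 @ [E0]) (replicate c E1)"
      by simp
    also have "\<dots> = (\<Sum>j\<le>Suc c. one_gap (Suc n + j) (Suc c - j) (of_nat ((n + j) choose j)))
        + (\<Sum>j\<le>c. one_gap (Suc n + Suc j) (c - j) (of_nat ((Suc n + j) choose j)))"
      unfolding outer Suc
      by (simp add: sum_distrib_left e1_mult_one_gap del: sum.atMost_Suc binomial_Suc_Suc)
    also have "\<dots> = one_gap (Suc n) (Suc c) 1 + (\<Sum>j\<le>c. one_gap (Suc n + Suc j) (c - j)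
        (of_nat ((n + Suc j) choose Suc j)) + one_gap (Suc n + Suc j) (c - j) (of_nat ((Suc n + j) choose j)))"
      by (simp add: sum.atMost_Suc_shift sum.distrib add.assoc del: sum.atMost_Suc binomial_Suc_Suc)
    also have "\<dots> = one_gap (Suc n) (Suc c) 1
        + (\<Sum>j\<le>c. one_gap (Suc n + Suc j) (c - j) (of_nat ((Suc n + Suc j) choose Suc j)))"
      unfolding one_gap_add[symmetric] by (simp add: add.commute)
    also have "\<dots> = (\<Sum>j\<le>Suc c. one_gap (Suc n + j) (Suc c - j) (of_nat ((Suc n + j) choose j)))"
      by (simp add: sum.atMost_Suc_shift del: sum.atMost_Suc binomial_Suc_Suc)
    finally show ?case .
  qed (simp add: one_gap_def)
qed

lemma index_word_ones: "index_word (replicate n 1) = replicate n E1"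
  by (induction n) (simp_all add: index_word_def)

lemma zmon_one_gap: "zmon (replicate a 1 @ [2] @ replicate c 1) = one_gap (Suc a) c 1"
proof -
  have "index_word [2] = [E1, E0]" by (simp add: index_word_def)
  then have "index_word (replicate a 1 @ [2] @ replicate c 1) = replicate (Suc a) E1 @ E0 # replicate c E1"
    by (simp only: index_word_append index_word_ones) (simp add: replicate_app_Cons_same)
  then show ?thesis by (simp only: zmon_eq_single one_gap_def)
qed

text \<open>The product of the binomials equals \<open>binom(n + c, n) * binom(c, j)\<close>, and an
  alternating row sum of Pascal's triangle vanishes.\<close>

lemma binomial_alternating_product:
  assumes "0 < c"
  shows "(\<Sum>j\<le>c. (-1) ^ (c - j) * real ((n + j) choose j) * real ((n + c) choose (c - j))) = 0"
proof -
  have "(-1) ^ (c - j) * real ((n + j) choose j) * real ((n + c) choose (c - j)) =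
      (-1) ^ c * real ((n + c) choose n) * ((-1) ^ j * real (c choose j))" if j: "j \<le> c" for j
  proof -
    have "((n + c) choose (n + j)) * ((n + j) choose n) = ((n + c) choose n) * (c choose j)"
      using choose_mult[of n "n + j" "n + c"] that by simp
    moreover have "(n + c) choose (c - j) = (n + c) choose (n + j)"
      using binomial_symmetric[of "n + j" "n + c"] that by simp
    moreover have "(n + j) choose j = (n + j) choose n"
      using binomial_symmetric[of j "n + j"] by simp
    ultimately have binom: "real ((n + j) choose j) * real ((n + c) choose (c - j)) = real ((n + c) choose n) * real (c choose j)"
      by (simp only: mult.commute flip: of_nat_mult)
    obtain d where d: "c = j + d" using le_Suc_ex[OF j] by blast
    have "(-1 :: real) ^ j * (-1) ^ j = 1"
      by (simp only: power_mult_distrib[symmetric]) simp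
    moreover have "(-1 :: real) ^ c * (-1) ^ j = (-1) ^ d * ((-1) ^ j * (-1) ^ j)"
      unfolding d by (simp only: power_add mult_ac)
    ultimately have sign: "(-1 :: real) ^ (c - j) = (-1) ^ c * (-1) ^ j"
      using d by simp
    show ?thesis
      unfolding mult.assoc binom sign by (simp only: mult.left_commute)
  qed
  then have "(\<Sum>j\<le>c. (-1) ^ (c - j) * real ((n + j) choose j) * real ((n + c) choose (c - j))) =
      (-1) ^ c * real ((n + c) choose n) * (\<Sum>j\<le>c. (-1) ^ j * real (c choose j))"
    unfolding sum_distrib_left by (intro sum.cong) auto
  then show ?thesis
    using choose_alternating_sum[OF assms, where 'a = real] by simp
qed

text \<open>All words in the expansion have weight \<open>a + c + 2\<close>, so the same zeta value
  comes out of every term and the recursion reduces to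
  \<open>binomial_alternating_product\<close>.\<close>

lemma val_shuffle_ones_two_ones:
  assumes "regularization shuffle_prod F"
  shows "regularization.val F (zmon (replicate a 1 @ [2] @ replicate c 1)) =
    (-1) ^ c * real ((a + c + 1) choose c) * mzv [a + c + 2]"
proof -
  interpret regularization shuffle_prod F by fact
  have wH1: "Poly_Mapping.single (Word (E1 # u)) q \<in> H1" for u q
    by (auto simp: H1_iff)
  have gH1: "one_gap (Suc n) c q \<in> H1" for n c q
    by (simp add: one_gap_def wH1)
  have gval: "val (one_gap (Suc n) c (of_nat m)) = real m * val (one_gap (Suc n) c 1)" for n c m
  proof -
    have "one_gap (Suc n) c (of_nat m) = scal (of_nat m) * one_gap (Suc n) c 1"
      by (simp add: one_gap_def scal_mult_single)
    then show ?thesis by (simp add: val_scal_mult gH1)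
  qed
  \<comment> \<open>\<open>zgen 1\<close> has value 0 and its shuffle with \<open>e1^c\<close> is a
    nonzero multiple of \<open>e1^(c + 1)\<close>.\<close>
  have ones: "val (Poly_Mapping.single (Word (replicate (Suc c) E1)) 1) = 0" for c
  proof -
    let ?w = "\<lambda>c. Poly_Mapping.single (Word (replicate c E1)) (1 :: rat)"
    have H: "?w c \<in> H1" for c
      by (cases c) (auto simp: H1_iff)
    have "zgen 1 = ?w 1" by (simp add: zgen_eq_single)
    then have "val (?w 1) = 0" using val_zgen_1 by simp
    then have "0 = val (shuffle_prod (?w 1) (?w c))"
      by (simp only: val_mult[OF H H] mult_zero_left)
    also have "shuffle_prod (?w 1) (?w c) = scal (of_nat (Suc c)) * ?w (Suc c)"
      using shuffle_E1_ones[of c] by (simp add: shuffle_prod_words scal_mult_single)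
    also have "val \<dots> = real (Suc c) * val (?w (Suc c))"
      by (subst val_scal_mult[OF H]) (simp only: of_rat_of_nat_eq)
    finally show ?thesis by simp
  qed
  have "val (one_gap (Suc a) c 1) = (-1) ^ c * real ((a + c + 1) choose c) * mzv [a + c + 2]"
  proof (induction c arbitrary: a rule: less_induct)
    case (less c)
    show ?case
    proof (cases c)
      case 0
      have "one_gap (Suc a) 0 1 = zmon (replicate a 1 @ [2])"
        using zmon_one_gap[of a 0] by simp
      also have "val \<dots> = mzv [a + 2]"
        using mzv_ones_two[of a] by (subst val_zmon_admissible) (auto simp: admissible_def)
      finally show ?thesis using 0 by simp
    next
      case (Suc m)
      let ?b = "\<lambda>j. (-1) ^ (c - j) * real ((Suc a + j) choose j) * real ((Suc a + c) choose (c - j))"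
      have "0 = val (shuffle_prod (Poly_Mapping.single (Word (replicate (Suc a) E1 @ [E0])) 1)
          (Poly_Mapping.single (Word (replicate c E1)) 1))"
        using ones[of m] Suc by (subst val_mult) (auto simp: wH1)
      also have "\<dots> = (\<Sum>j\<le>c. real ((Suc a + j) choose j) * val (one_gap (Suc a + j) (c - j) 1))"
        unfolding shuffle_prod_words shuffle_one_gap_ones
        by (subst val_sum) (auto simp: gH1 gval simp del: binomial_Suc_Suc)
      also have "\<dots> = val (one_gap (Suc a) c 1)
          + (\<Sum>j\<in>{1..c}. real ((Suc a + j) choose j) * val (one_gap (Suc a + j) (c - j) 1))"
      proof -
        have "{..c} = insert 0 {1..c}" by auto
        then show ?thesis by simp
      qed
      also have "(\<Sum>j\<in>{1..c}. real ((Suc a + j) choose j) * val (one_gap (Suc a + j) (c - j) 1)) =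
          (\<Sum>j\<in>{1..c}. ?b j * mzv [a + c + 2])"
      proof (rule sum.cong[OF refl])
        fix j assume j: "j \<in> {1..c}"
        \<comment> \<open>Here \<open>a\<close> grows to \<open>a + j\<close> while \<open>c\<close>
          drops to \<open>c - j\<close>, hence the induction over arbitrary
          \<open>a\<close>.\<close>
        then have "val (one_gap (Suc (a + j)) (c - j) 1) =
            (-1) ^ (c - j) * real ((a + j + (c - j) + 1) choose (c - j)) * mzv [a + j + (c - j) + 2]"
          by (intro less.IH) auto
        moreover have "a + j + (c - j) + 1 = Suc a + c" "a + j + (c - j) + 2 = a + c + 2"
          using j by auto
        ultimately show "real ((Suc a + j) choose j) * val (one_gap (Suc a + j) (c - j) 1) = ?b j * mzv [a + c + 2]"
          by (simp only: add_Suc mult_ac)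
      qed
      also have "(\<Sum>j\<in>{1..c}. ?b j * mzv [a + c + 2]) = - ?b 0 * mzv [a + c + 2]"
      proof -
        have "(\<Sum>j\<le>c. ?b j) = 0"
          using Suc by (intro binomial_alternating_product) simp
        moreover have "{..c} = insert 0 {1..c}" by auto
        ultimately have "(\<Sum>j\<in>{1..c}. ?b j) = - ?b 0"
          by (simp del: binomial_Suc_Suc)
        then show ?thesis by (simp only: sum_distrib_right[symmetric])
      qed
      finally show ?thesis by simp
    qed
  qed
  then show ?thesis by (simp only: zmon_one_gap)
qed

theorem theoremA2:
  fixes Zst Zsh :: "hoffman \<Rightarrow> real poly" and a c :: nat
  assumes "is_regularization stuffle_prod Zst"
    and "is_regularization shuffle_prod Zsh"
  shows "reg_value Zsh (replicate a 1 @ [2] @ replicate c 1)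
           \<in> rat_subalgebra ({pi\<^sup>2} \<union> {mzv [2 * n + 1] | n. n \<ge> 1})
       \<and> reg_value Zst (replicate a 1 @ [2] @ replicate c 1)
           \<in> rat_subalgebra ({pi\<^sup>2} \<union> {mzv [2 * n + 1] | n. n \<ge> 1})
       \<and> reg_value Zsh (replicate a 1 @ [2] @ replicate c 1)
           = (- 1) ^ c * real ((a + c + 1) choose c) * mzv [a + c + 2]
       \<and> reg_value Zst (replicate a 1 @ [2] @ replicate c 1)
           = (- 1) ^ c * (\<Sum>s=0..c. real ((a + c - s + 1) choose (c - s))
               * mzv [a + c - s + 2] * Cseq s)"
proof -
  interpret st: regularization stuffle_prod Zst by standard fact
  interpret sh: regularization shuffle_prod Zsh by standard fact
  let ?A = "rat_subalgebra ({pi\<^sup>2} \<union> {mzv [2 * n + 1] | n. n \<ge> 1})"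
  \<comment> \<open>Odd arguments are generators, even ones come from Newton's identities;
    \<open>2 \<le> k\<close> excludes the divergent case.\<close>
  have zeta: "mzv [k] \<in> ?A" if "2 \<le> k" for k
  proof (cases "even k")
    case True
    then obtain n where "k = 2 * n" by blast
    with that show ?thesis
      using zeta_even_in_rat_subalgebra[of _ n] by auto
  next
    case False
    then obtain n where n: "k = 2 * n + 1" by (rule oddE)
    show ?thesis
      unfolding n by (rule rat_subalgebra.intros(2)) (use that n in auto)
  qed
  have sign: "(-1) ^ n \<in> ?A" for n
    using rat_subalgebra_of_nat[of 1] by (intro rat_subalgebra_power rat_subalgebra_uminus) simp
  \<comment> \<open>The defining sum involves only \<open>\<zeta>(i)\<close> with
    \<open>i \<ge> 2\<close> and rational factors.\<close>
  have Cseq: "Cseq s \<in> ?A" for s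
  proof -
    have divide_fact: "x / fact n \<in> ?A" if "x \<in> ?A" for x n
      using rat_subalgebra_divide_nat[OF that, of "fact n"] by simp
    then show ?thesis
      unfolding Cseq_eq_exp_coeff exp_coeff_def exp_weight_def
      by (intro rat_subalgebra_sum rat_subalgebra_prod divide_fact rat_subalgebra_power rat_subalgebra_uminus
          rat_subalgebra_divide_nat zeta) auto
  qed
  have sh: "reg_value Zsh (replicate a 1 @ [2] @ replicate c 1)
      = (- 1) ^ c * real ((a + c + 1) choose c) * mzv [a + c + 2]"
    using val_shuffle_ones_two_ones[OF sh.regularization_axioms]
    by (simp only: reg_value_def sh.val_def)
  have st: "reg_value Zst (replicate a 1 @ [2] @ replicate c 1)
      = (- 1) ^ c * (\<Sum>s=0..c. real ((a + c - s + 1) choose (c - s)) * mzv [a + c - s + 2] * Cseq s)"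
    using val_stuffle_ones_two_ones[OF st.regularization_axioms]
    by (simp only: reg_value_def st.val_def)
  have "reg_value Zsh (replicate a 1 @ [2] @ replicate c 1) \<in> ?A"
    unfolding sh by (intro rat_subalgebra.intros(4) sign rat_subalgebra_of_nat zeta) simp
  moreover have "reg_value Zst (replicate a 1 @ [2] @ replicate c 1) \<in> ?A"
    unfolding st
    by (intro rat_subalgebra.intros(4) rat_subalgebra_sum sign rat_subalgebra_of_nat zeta Cseq) simp
  ultimately show ?thesis
    using sh st by blast
qed

end
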